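(* Fix integers $a\geq b\geq 2$. There exists an $M$ ($M=a^2+ab-2a+1$ suffices) such that whenever $A,B\geq 2$ are integers with $A+B\geq M$ and $$\frac{B-b+1}{A}\geq\frac{b-1}{a}\qquad\text{and}\qquad\frac{A-b+1}{B}\geq\frac{b-1}{a},$$ there exists a homogeneous polynomial mapping $F\colon HQ(a,b)\to HQ(A,B)$ with linearly independent components. That is, there exists a rational CR mapping $\tilde F\colon Q(a,b-1)\to Q(A,B-1)$ whose image is not contained in a complex hyperplane.
   Context: For nonnegative integers $a,b$, $$Q(a,b)=\Bigl\{z\in\mathbb{C}^{a+b}:\sum_{j=1}^a|z_j|^2-\sum_{j=a+1}^{a+b}|z_j|^2=1\Bigr\},\qquad HQ(a,b)=\Bigl\{z\in\mathbb{C}^{a+b}:\sum_{j=1}^a|z_j|^2-\sum_{j=a+1}^{a+b}|z_j|^2=0\Bigr\}.$$ A homogeneous polynomial mapping $F\colon HQ(a,b)\to HQ(A,B)$ is a mapping $F\colon\mathbb{C}^{a+b}\to\mathbb{C}^{A+B}$ all of whose components are homogeneous holomorphic polynomials of one common degree and such that $F(HQ(a,b))\subset HQ(A,B)$. Its components are linearly independent if they are linearly independent over $\mathbb{C}$ as polynomials. A rational CR mapping $Q(a,b-1)\to Q(A,B-1)$ is a rational mapping $\mathbb{C}^{a+b-1}\dashrightarrow\mathbb{C}^{A+B-1}$ that takes the points of $Q(a,b-1)$ off its poles into $Q(A,B-1)$; it is obtained from $F$ by setting the last variable $z_{a+b}=1$ and dividing by the last component of $F$. A complex hyperplane is a complex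 affine subspace of complex codimension one. *)

theory Defs
  imports
    Complex_Main
    "HOL-Library.Function_Algebras"
    "HOL-Library.Poly_Mapping"
    "HOL-Computational_Algebra.Fraction_Field"
begin

text \<open>
  A point of \<open>\<complex>\<^sup>n\<close> is a function \<open>nat \<Rightarrow> complex\<close> vanishing at all indices \<open>\<ge> n\<close>.
  Coordinates are numbered from \<open>0\<close>: the coordinate \<open>z\<^sub>j\<close> of the informal notation is \<open>z (j - 1)\<close>.
\<close>

definition cspace :: "nat \<Rightarrow> (nat \<Rightarrow> complex) set" where
  "cspace n = {z. \<forall>i\<ge>n. z i = 0}"

definition herm :: "nat \<Rightarrow> nat \<Rightarrow> (nat \<Rightarrow> complex) \<Rightarrow> real" where
  "herm a b z = (\<Sum>j<a. (cmod (z j))\<^sup>2) - (\<Sum>j=a..<a + b. (cmod (z j))\<^sup>2)"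

definition Q :: "nat \<Rightarrow> nat \<Rightarrow> (nat \<Rightarrow> complex) set" where
  "Q a b = {z \<in> cspace (a + b). herm a b z = 1}"

definition HQ :: "nat \<Rightarrow> nat \<Rightarrow> (nat \<Rightarrow> complex) set" where
  "HQ a b = {z \<in> cspace (a + b). herm a b z = 0}"


text \<open>
  Polynomials: finitely supported maps from exponent vectors to coefficients, with the
  convolution product of \<open>Poly_Mapping\<close>.
\<close>

type_synonym cpoly = "(nat \<Rightarrow>\<^sub>0 nat) \<Rightarrow>\<^sub>0 complex"

definition polys_in :: "nat \<Rightarrow> cpoly set" where
  "polys_in n = {p. \<forall>m \<in> Poly_Mapping.keys p. Poly_Mapping.keys m \<subseteq> {..<n}}"

definition poly_eval :: "cpoly \<Rightarrow> (nat \<Rightarrow> complex) \<Rightarrow> complex" where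
  "poly_eval p z =
     (\<Sum>m \<in> Poly_Mapping.keys p. Poly_Mapping.lookup p m *
        (\<Prod>i \<in> Poly_Mapping.keys m. z i ^ Poly_Mapping.lookup m i))"

definition homogeneous_of_degree :: "nat \<Rightarrow> cpoly \<Rightarrow> bool" where
  "homogeneous_of_degree d p \<longleftrightarrow>
     (\<forall>m \<in> Poly_Mapping.keys p. (\<Sum>i \<in> Poly_Mapping.keys m. Poly_Mapping.lookup m i) = d)"

text \<open>
  A polynomial mapping into \<open>\<complex>\<^sup>N\<close> is given by its components \<open>F 0, \<dots>, F (N - 1)\<close>;
  the polynomials \<open>F j\<close> with \<open>j \<ge> N\<close> play no role.
\<close>

definition poly_map_eval :: "nat \<Rightarrow> (nat \<Rightarrow> cpoly) \<Rightarrow> (nat \<Rightarrow> complex) \<Rightarrow> (nat \<Rightarrow> complex)" where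
  "poly_map_eval N F z = (\<lambda>j. if j < N then poly_eval (F j) z else 0)"

definition homogeneous_poly_mapping_HQ ::
  "nat \<Rightarrow> nat \<Rightarrow> nat \<Rightarrow> nat \<Rightarrow> (nat \<Rightarrow> cpoly) \<Rightarrow> bool" where
  "homogeneous_poly_mapping_HQ a b A B F \<longleftrightarrow>
     (\<forall>j < A + B. F j \<in> polys_in (a + b)) \<and>
     (\<exists>d. \<forall>j < A + B. homogeneous_of_degree d (F j)) \<and>
     poly_map_eval (A + B) F ` HQ a b \<subseteq> HQ A B"

definition lin_indep_components :: "nat \<Rightarrow> (nat \<Rightarrow> cpoly) \<Rightarrow> bool" where
  "lin_indep_components N F \<longleftrightarrow>
     (\<forall>c :: nat \<Rightarrow> complex.
        (\<Sum>j<N. Poly_Mapping.single 0 (c j) * F j) = 0 \<longrightarrow> (\<forall>j<N. c j = 0))"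


definition rational_functions_in :: "nat \<Rightarrow> cpoly fract set" where
  "rational_functions_in n =
     {r. \<exists>p \<in> polys_in n. \<exists>q \<in> polys_in n. q \<noteq> 0 \<and> r = Fract p q}"

text \<open>
  The point \<open>z\<close> is off the poles of \<open>r\<close>, and \<open>r\<close> takes the value \<open>w\<close> at \<open>z\<close>.  The
  representation of \<open>r\<close> as a quotient may depend on \<open>z\<close>, so the poles are those of \<open>r\<close> itself
  and not the zeros of the denominator of a particular, possibly unreduced, representation.
\<close>

definition rat_has_value :: "nat \<Rightarrow> cpoly fract \<Rightarrow> (nat \<Rightarrow> complex) \<Rightarrow> complex \<Rightarrow> bool" where
  "rat_has_value n r z w \<longleftrightarrow>
     (\<exists>p \<in> polys_in n. \<exists>q \<in> polys_in n.
        r = Fract p q \<and> poly_eval q z \<noteq> 0 \<and> w = poly_eval p z / poly_eval q z)"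

text \<open>
  The image of \<open>S\<close> under a rational mapping from \<open>\<complex>\<^sup>n\<close> to \<open>\<complex>\<^sup>N\<close>, that is, the set of its values
  at those points of \<open>S\<close> that are poles of no component.
\<close>

definition rat_map_image ::
  "nat \<Rightarrow> nat \<Rightarrow> (nat \<Rightarrow> cpoly fract) \<Rightarrow> (nat \<Rightarrow> complex) set \<Rightarrow> (nat \<Rightarrow> complex) set" where
  "rat_map_image n N R S =
     {w \<in> cspace N. \<exists>z \<in> S. \<forall>j<N. rat_has_value n (R j) z (w j)}"

definition rational_CR_mapping_Q ::
  "nat \<Rightarrow> nat \<Rightarrow> nat \<Rightarrow> nat \<Rightarrow> (nat \<Rightarrow> cpoly fract) \<Rightarrow> bool" where
  "rational_CR_mapping_Q a b A B R \<longleftrightarrow>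
     (\<forall>j < A + B. R j \<in> rational_functions_in (a + b)) \<and>
     rat_map_image (a + b) (A + B) R (Q a b) \<subseteq> Q A B"

text \<open>Substitution of \<open>1\<close> for the variable with index \<open>k\<close>.\<close>

definition set_var_one :: "nat \<Rightarrow> cpoly \<Rightarrow> cpoly" where
  "set_var_one k p =
     (\<Sum>m \<in> Poly_Mapping.keys p.
        Poly_Mapping.single (Poly_Mapping.update k 0 m) (Poly_Mapping.lookup p m))"

text \<open>
  The rational mapping from \<open>\<complex>\<^sup>n\<^sup>-\<^sup>1\<close> to \<open>\<complex>\<^sup>N\<^sup>-\<^sup>1\<close> obtained from \<open>F : \<complex>\<^sup>n \<rightarrow> \<complex>\<^sup>N\<close> by setting the last
  variable to \<open>1\<close> and dividing by the last component.
\<close>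

definition dehomogenization ::
  "nat \<Rightarrow> nat \<Rightarrow> (nat \<Rightarrow> cpoly) \<Rightarrow> (nat \<Rightarrow> cpoly fract)" where
  "dehomogenization n N F =
     (\<lambda>j. Fract (set_var_one (n - 1) (F j)) (set_var_one (n - 1) (F (N - 1))))"


interpretation cfun: vector_space "\<lambda>(c :: complex) (v :: nat \<Rightarrow> complex) i. c * v i"
  by unfold_locales (auto simp: fun_eq_iff algebra_simps)

text \<open>Translates of complex linear subspaces of \<open>\<complex>\<^sup>n\<close> of complex dimension \<open>n - 1\<close>.\<close>

definition complex_hyperplane :: "nat \<Rightarrow> (nat \<Rightarrow> complex) set \<Rightarrow> bool" where
  "complex_hyperplane n H \<longleftrightarrow>
     (\<exists>u \<in> cspace n. \<exists>V. V \<subseteq> cspace n \<and> cfun.subspace V \<and> cfun.dim V + 1 = n \<and>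
        H = (\<lambda>v. u + v) ` V)"

end

theory Submission
  imports Defs
begin

text \<open>
  Put \<open>x\<^sub>j = \<bar>z\<^sub>j\<bar>\<^sup>2\<close> and \<open>s = x\<^sub>1 + \<dots> + x\<^sub>a - x\<^sub>a\<^sub>+\<^sub>1 - \<dots> - x\<^sub>a\<^sub>+\<^sub>b\<close>. A homogeneous real polynomial in \<open>x\<close> that
  vanishes on \<open>s = 0\<close> and has \<open>A\<close> positive and \<open>B\<close> negative coefficients \<open>c\<^sub>m\<close> yields the map with the
  monomial components \<open>\<surd>\<bar>c\<^sub>m\<bar> z\<^sup>m\<close>. Let \<open>v\<close> be the last variable. From such a polynomial \<open>f\<close> and a
  monomial \<open>\<mu>\<close> of \<open>f\<close> that does not contain \<open>v\<close>, with coefficient \<open>c > 0\<close>, one passes to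
  \<open>v f + \<gamma> \<mu> s\<close>. The two summands share only the monomial \<open>\<mu> v\<close>, so this block adds \<open>(a - 1, b - 1)\<close>
  to \<open>(A, B)\<close>, plus \<open>(0, 0)\<close>, \<open>(1, 0)\<close> or \<open>(0, 1)\<close> as \<open>\<gamma>\<close> is equal to, below or above \<open>c\<close>; a
  disjoint block, for \<open>v\<^sup>2 f\<close>, gives \<open>(1, 1)\<close>. Changing signs gives the same with \<open>(b - 1, a - 1)\<close>.
  Hence with \<open>k\<close> positive and \<open>l\<close> negative blocks all pairs in the square
  \<open>(a - 1) k + (b - 1) l < A \<le> a k + b l\<close>, \<open>(b - 1) k + (a - 1) l < B \<le> b k + a l\<close> occur, and these
  squares cover the required part of the cone.
\<close>

section \<open>Covering the cone by squares\<close>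

text \<open>
  Here \<open>p = a - 1\<close> and \<open>q = b - 1\<close>; \<open>k\<close> and \<open>l\<close> are the numbers of positive and negative
  blocks. For given \<open>l\<close> one takes the least \<open>k\<close> with \<open>A \<le> a k + b l\<close>. When \<open>l\<close> grows by one, the
  interval of admissible \<open>B\<close> moves up without leaving a gap, provided \<open>k + l \<ge> a\<close>.
\<close>

lemma covering_walk:
  fixes p q A B k l :: nat
  assumes "1 \<le> q" "q \<le> p" "B \<le> A" "1 \<le> k"
    and "A \<le> (p + 1) * k + (q + 1) * l" "(p + 1) * k + (q + 1) * l \<le> A + p"
    and "p + 1 \<le> k + l" "q * k + p * l + 1 \<le> B"
  shows "\<exists>k l. p * k + q * l + 1 \<le> A \<and> A \<le> (p + 1) * k + (q + 1) * l \<and>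
               q * k + p * l + 1 \<le> B \<and> B \<le> (q + 1) * k + (p + 1) * l"
  using assms
proof (induction "B - l" arbitrary: k l rule: less_induct)
  case less
  show ?case
  proof (cases "B \<le> (q + 1) * k + (p + 1) * l")
    case True
    then show ?thesis
      using less.prems by (intro exI[of _ k] exI[of _ l]) (auto simp: algebra_simps)
  next
    case False
    have "l \<le> p * l"
      using assms(1) less.prems by (cases p) auto
    then have lB: "l < B"
      using less.prems by linarith
    \<comment> \<open>The interval for \<open>B\<close> has \<open>k + l > p\<close> points and
      \<open>B\<close> lies above it, so raising the lower end by \<open>p\<close> still leaves it
      at most \<open>B\<close>.\<close>
    have low: "q * k + p * (l + 1) + 1 \<le> B"
      using False less.prems by (simp add: algebra_simps)
    show ?thesis
    proof (cases "A \<le> (p + 1) * (k - 1) + (q + 1) * (l + 1)")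
      case False
      show ?thesis
        by (rule less.hyps[of "l + 1" k]) (use False less.prems lB low in \<open>auto simp: algebra_simps diff_mult_distrib2\<close>)
    next
      case True
      obtain k' where k: "k = Suc k'"
        using less.prems by (cases k) auto
      show ?thesis
      proof (cases "k' = 0")
        case True
        \<comment> \<open>With no positive block left the walk stops:
          \<open>B \<le> A \<le> (q + 1) * (l + 1)\<close> settles the upper bound on
          \<open>B\<close>, and \<open>q \<le> p \<le> l\<close> the lower bound on
          \<open>A\<close>.\<close>
        have 1: "q * l + q + 1 \<le> A" "A \<le> (q + 1) * (l + 1)"
          using less.prems k True \<open>A \<le> (p + 1) * (k - 1) + _\<close> by (auto simp: algebra_simps)
        have 2: "(q + 1) * (l + 1) \<le> (p + 1) * (l + 1)"
          using less.prems by (intro mult_right_mono) auto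
        show ?thesis
          using 1 2 low less.prems
          by (intro exI[of _ 0] exI[of _ "l + 1"]) (auto simp: algebra_simps)
      next
        case False
        show ?thesis
          by (rule less.hyps[of "l + 1" k']) (use False True less.prems lB low k in \<open>auto simp: algebra_simps\<close>)
      qed
    qed
  qed
qed

text \<open>Finds a starting pair for the walk. For large \<open>A\<close> it has
  \<open>l = 0\<close>, and the cone inequality bounds \<open>q * k\<close>. For small
  \<open>A\<close> it is sought near the diagonal \<open>k + l = p\<close>, and the bound on
  \<open>A + B\<close> does the work.\<close>

lemma covering_half:
  fixes p q A B :: nat
  assumes "1 \<le> q" "q \<le> p" "B \<le> A"
    and sz: "(p + 1) * (p + q) + 1 \<le> A + B" and cone: "q * A + (p + 1) * q \<le> (p + 1) * B"
  shows "\<exists>k l. p * k + q * l + 1 \<le> A \<and> A \<le> (p + 1) * k + (q + 1) * l \<and>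
               q * k + p * l + 1 \<le> B \<and> B \<le> (q + 1) * k + (p + 1) * l"
proof (cases "(p + 1) * p < A")
  case True
  \<comment> \<open>\<open>k + 1\<close> is \<open>A / (p + 1)\<close> rounded up.\<close>
  define k where "k = (A - 1) div (p + 1)"
  have k1: "(p + 1) * k < A" "A \<le> (p + 1) * (k + 1)"
  proof -
    have "A - 1 = (p + 1) * k + (A - 1) mod (p + 1)"
      unfolding k_def by (rule mult_div_mod_eq[symmetric])
    moreover have "(A - 1) mod (p + 1) < p + 1" by simp
    moreover have "(p + 1) * (k + 1) = (p + 1) * k + (p + 1)" by (simp add: algebra_simps)
    ultimately show "(p + 1) * k < A" "A \<le> (p + 1) * (k + 1)"
      using True by linarith+
  qed
  have "(p + 1) * p < (p + 1) * (k + 1)" using True k1 by linarith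
  then have pk: "p < k + 1" by (metis mult_less_cancel1)
  have "q * ((p + 1) * k) < q * A"
    using k1 assms by (intro mult_strict_left_mono) auto
  then have "(p + 1) * (q * (k + 1)) < (p + 1) * B"
    using cone by (simp add: algebra_simps)
  then have "q * (k + 1) < B" by (metis mult_less_cancel1)
  then show ?thesis
    using k1 pk assms by (intro covering_walk[of q p B A "k + 1" 0]) (auto simp: algebra_simps)
next
  case False
  obtain r where r: "p = q + r" using assms le_Suc_ex by blast
  \<comment> \<open>On \<open>k + l = p\<close> the upper bound on \<open>A\<close> reads
    \<open>A + r * l \<le> (p + 1) * p\<close>, and \<open>P l\<close> is its failure. With
    \<open>m\<close> the first failure and \<open>l = m - 1\<close>, the candidates are
    \<open>(k, l)\<close> on this diagonal and \<open>(k, m)\<close> on the next.\<close>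
  define P where "P l \<longleftrightarrow> (p + 1) * p < A + r * l" for l
  have Blow: "(p + 1) * q + 1 \<le> B"
    using False sz by (simp add: algebra_simps)
  have "P (p + 1)"
    using Blow assms unfolding P_def r by (simp add: algebra_simps)
  define m where "m = (LEAST l. P l)"
  have Pm: "P m" and mle: "m \<le> p + 1"
    unfolding m_def using \<open>P (p + 1)\<close> by (auto intro: LeastI Least_le)
  have "m \<noteq> 0"
  proof
    assume "m = 0"
    then show False
      using Pm False by (simp add: P_def)
  qed
  then obtain l where l: "m = Suc l" by (cases m) auto
  have "\<not> P l"
    using l unfolding m_def by (metis lessI not_less_Least)
  obtain k where k: "p = k + l" using mle l by (metis add_le_cancel_right add.commute Suc_eq_plus1 le_Suc_ex)
  have u: "A + r * l \<le> (p + 1) * p" using \<open>\<not> P l\<close> by (simp add: P_def)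
  have u': "(p + 1) * p < A + r * l + r" using Pm l by (simp add: P_def)
  \<comment> \<open>For \<open>k = 0\<close> the bound on \<open>A\<close> together with
    \<open>B \<le> A\<close> makes \<open>A + B\<close> too small.\<close>
  have "k \<noteq> 0"
  proof
    assume "k = 0"
    then have "A + r * p \<le> (p + 1) * p" using u k by simp
    then have *: "A \<le> p * (q + 1)" unfolding r by (simp add: algebra_simps)
    have "(p + 1) * (p + q) + 1 \<le> 2 * (p * (q + 1))"
      using * sz assms by linarith
    moreover obtain t where "p = Suc t" using assms by (cases p) auto
    moreover have "t * q \<le> t * p" using assms by simp
    ultimately show False using assms by (simp add: algebra_simps)
  qed
  show ?thesis
  proof (cases "q * k + p * m + 1 \<le> B")
    case True
    show ?thesis
    proof (rule covering_walk[of q p B A k m])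
      have e: "(p + 1) * k + (q + 1) * m + r * m = (p + 1) * (p + 1)"
        unfolding l using k r by (metis (no_types, lifting) add.assoc add.commute add_Suc_right distrib_left distrib_right plus_1_eq_Suc)
      have f: "(p + 1) * (p + 1) = (p + 1) * p + p + 1" by simp
      show "A \<le> (p + 1) * k + (q + 1) * m" "(p + 1) * k + (q + 1) * m \<le> A + p"
        using u u' e f r by (simp_all add: l)
    qed (use assms True k l \<open>k \<noteq> 0\<close> in auto)
  next
    \<comment> \<open>\<open>m\<close> is the first index where \<open>k + l = a\<close>; just before it \<open>k + l = a - 1\<close>, and the bound on
      \<open>A + B\<close> is exactly what makes that pair work.\<close>
    case False
    have "(q + 1) * l + r * l = (p + 1) * l" "p * l = q * l + r * l"
      unfolding r by (simp_all add: algebra_simps)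
    moreover have "(p + 1) * k + (p + 1) * l = (p + 1) * p" "q * k + q * l = q * p"
      unfolding k by (simp_all add: algebra_simps)
    ultimately have e: "(p + 1) * k + (q + 1) * l + r * l = (p + 1) * p"
      and e2: "q * k + p * l = q * p + r * l"
      by linarith+
    have e3: "(p + 1) * k + (q + 1) * l = p * k + q * l + p" "(q + 1) * k + (p + 1) * l = q * k + p * l + p"
      using k by (simp_all add: algebra_simps)
    have e4: "(p + 1) * (p + q) = (p + 1) * p + q * p + q" by (simp add: algebra_simps)
    have "q * k + p * l + 1 \<le> B"
      using u sz e2 e4 by linarith
    moreover have "B \<le> (q + 1) * k + (p + 1) * l"
      using False e3 l by simp
    moreover have "A \<le> (p + 1) * k + (q + 1) * l" "p * k + q * l + 1 \<le> A"
      using u u' e e3 r assms by linarith+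
    ultimately show ?thesis by blast
  qed
qed

text \<open>Interchanging \<open>A\<close> and \<open>B\<close> interchanges \<open>k\<close> and
  \<open>l\<close>, which reduces to \<open>B \<le> A\<close>.\<close>

lemma covering:
  fixes p q A B :: nat
  assumes "1 \<le> q" "q \<le> p" "(p + 1) * (p + q) + 1 \<le> A + B"
    and "q * A + (p + 1) * q \<le> (p + 1) * B" "q * B + (p + 1) * q \<le> (p + 1) * A"
  shows "\<exists>k l. p * k + q * l + 1 \<le> A \<and> A \<le> (p + 1) * k + (q + 1) * l \<and>
               q * k + p * l + 1 \<le> B \<and> B \<le> (q + 1) * k + (p + 1) * l"
proof (cases "B \<le> A")
  case True
  then show ?thesis using covering_half assms by blast
next
  case False
  then obtain k l where "p * k + q * l + 1 \<le> B" "B \<le> (p + 1) * k + (q + 1) * l"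
      "q * k + p * l + 1 \<le> A" "A \<le> (q + 1) * k + (p + 1) * l"
    using covering_half[of q p A B] assms by (auto simp: add.commute)
  then show ?thesis
    by (intro exI[of _ l] exI[of _ k]) (auto simp: algebra_simps)
qed


section \<open>Polynomials with prescribed numbers of positive and negative coefficients\<close>

text \<open>The ring is left open: forms are evaluated at the real numbers \<open>|z_j|^2\<close>,
  maps at complex \<open>z\<close>.\<close>

definition mono_eval :: "(nat \<Rightarrow>\<^sub>0 nat) \<Rightarrow> (nat \<Rightarrow> 'a::comm_semiring_1) \<Rightarrow> 'a" where
  "mono_eval m x = (\<Prod>i \<in> Poly_Mapping.keys m. x i ^ Poly_Mapping.lookup m i)"

definition mono_degree :: "(nat \<Rightarrow>\<^sub>0 nat) \<Rightarrow> nat" where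
  "mono_degree m = (\<Sum>i \<in> Poly_Mapping.keys m. Poly_Mapping.lookup m i)"

abbreviation mono_var :: "nat \<Rightarrow> (nat \<Rightarrow>\<^sub>0 nat)" where
  "mono_var j \<equiv> Poly_Mapping.single j (Suc 0)"

lemma mono_eval_superset:
  assumes "finite K" "Poly_Mapping.keys m \<subseteq> K"
  shows "mono_eval m x = (\<Prod>i \<in> K. x i ^ Poly_Mapping.lookup m i)"
  unfolding mono_eval_def using assms
  by (intro prod.mono_neutral_left) (auto simp: not_in_keys_iff_lookup_eq_zero)

lemma mono_degree_superset:
  assumes "finite K" "Poly_Mapping.keys m \<subseteq> K"
  shows "mono_degree m = (\<Sum>i \<in> K. Poly_Mapping.lookup m i)"
  unfolding mono_degree_def using assms
  by (intro sum.mono_neutral_left) (auto simp: not_in_keys_iff_lookup_eq_zero)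

lemma keys_add_nat:
  "Poly_Mapping.keys (m + m' :: nat \<Rightarrow>\<^sub>0 nat) = Poly_Mapping.keys m \<union> Poly_Mapping.keys m'"
  by (auto simp: in_keys_iff lookup_add)

lemma mono_eval_add: "mono_eval (m + m') x = mono_eval m x * mono_eval m' x"
  by (simp add: mono_eval_superset[of "Poly_Mapping.keys m \<union> Poly_Mapping.keys m'"]
      keys_add_nat lookup_add power_add prod.distrib)

lemma mono_degree_add: "mono_degree (m + m') = mono_degree m + mono_degree m'"
  by (simp add: mono_degree_superset[of "Poly_Mapping.keys m \<union> Poly_Mapping.keys m'"]
      keys_add_nat lookup_add sum.distrib)

lemma mono_degree_zero [simp]: "mono_degree 0 = 0"
  by (simp add: mono_degree_def)

lemma mono_eval_single [simp]: "mono_eval (Poly_Mapping.single j k) x = x j ^ k"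
  by (cases "k = 0") (simp_all add: mono_eval_def)

lemma mono_degree_single [simp]: "mono_degree (Poly_Mapping.single j k) = k"
  by (cases "k = 0") (simp_all add: mono_degree_def)

lemma mono_minus_var:
  assumes "Poly_Mapping.lookup m v \<noteq> 0"
  shows "m - mono_var v + mono_var v = m"
  using assms by (intro poly_mapping_eqI) (auto simp: lookup_add lookup_minus lookup_single when_def)

section \<open>Real forms that vanish on \<open>s = 0\<close>\<close>

definition peval :: "((nat \<Rightarrow>\<^sub>0 nat) \<Rightarrow> real) \<Rightarrow> (nat \<Rightarrow> real) \<Rightarrow> real" where
  "peval c x = (\<Sum>m | c m \<noteq> 0. c m * mono_eval m x)"

lemma peval_superset:
  assumes "finite U" "{m. c m \<noteq> 0} \<subseteq> U"
  shows "peval c x = (\<Sum>m \<in> U. c m * mono_eval m x)"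
  unfolding peval_def using assms by (intro sum.mono_neutral_left) auto

definition var_sign :: "nat \<Rightarrow> nat \<Rightarrow> real" where
  "var_sign a j = (if j < a then 1 else - 1)"

definition vanishing_form :: "nat \<Rightarrow> nat \<Rightarrow> nat \<Rightarrow> ((nat \<Rightarrow>\<^sub>0 nat) \<Rightarrow> real) \<Rightarrow> bool" where
  "vanishing_form a b d c \<longleftrightarrow>
     finite {m. c m \<noteq> 0} \<and>
     (\<forall>m. c m \<noteq> 0 \<longrightarrow> Poly_Mapping.keys m \<subseteq> {..<a + b} \<and> mono_degree m = d) \<and>
     (\<forall>x. (\<Sum>j<a + b. var_sign a j * x j) = 0 \<longrightarrow> peval c x = 0)"

text \<open>
  The monomials free of the last variable are kept in the invariant because a new block can be
  attached to the rest of the form at such a monomial alone.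
\<close>

definition signature_pair :: "nat \<Rightarrow> nat \<Rightarrow> nat \<Rightarrow> nat \<Rightarrow> bool" where
  "signature_pair a b A B \<longleftrightarrow>
     (\<exists>d c. vanishing_form a b d c \<and> card {m. c m > 0} = A \<and> card {m. c m < 0} = B \<and>
        (\<exists>m. c m > 0 \<and> Poly_Mapping.lookup m (a + b - 1) = 0) \<and>
        (\<exists>m. c m < 0 \<and> Poly_Mapping.lookup m (a + b - 1) = 0))"

text \<open>Coefficients of the form multiplied by the variable \<open>v\<close>. The case split is
  there because subtraction of exponents is truncated.\<close>

definition shift_coeff :: "nat \<Rightarrow> ((nat \<Rightarrow>\<^sub>0 nat) \<Rightarrow> real) \<Rightarrow> (nat \<Rightarrow>\<^sub>0 nat) \<Rightarrow> real" where
  "shift_coeff v c m = (if Poly_Mapping.lookup m v = 0 then 0 else c (m - mono_var v))"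

lemma shift_coeff_add [simp]: "shift_coeff v c (m + mono_var v) = c m"
  by (simp add: shift_coeff_def lookup_add)

text \<open>One statement serves for positive, negative and nonzero coefficients; monomials without
  \<open>v\<close> have coefficient 0 and are excluded by \<open>\<not> P 0\<close>.\<close>

lemma Collect_shift_coeff:
  assumes "\<not> P 0"
  shows "{m. P (shift_coeff v c m)} = (\<lambda>m. m + mono_var v) ` {m. P (c m)}"
proof (intro equalityI subsetI)
  fix m
  assume "m \<in> {m. P (shift_coeff v c m)}"
  then have "Poly_Mapping.lookup m v \<noteq> 0" "P (c (m - mono_var v))"
    using assms by (auto simp: shift_coeff_def split: if_splits)
  then show "m \<in> (\<lambda>m. m + mono_var v) ` {m. P (c m)}"
    using mono_minus_var[of m v] by (metis (mono_tags, lifting) image_eqI mem_Collect_eq)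
qed auto

lemma card_shift_coeff:
  assumes "\<not> P 0"
  shows "card {m. P (shift_coeff v c m)} = card {m. P (c m)}"
  unfolding Collect_shift_coeff[where P = P, OF assms] by (intro card_image) (simp add: inj_on_def)

lemma vanishing_form_shift:
  assumes "vanishing_form a b d c" "v < a + b"
  shows "vanishing_form a b (d + 1) (shift_coeff v c)"
proof -
  have S: "{m. shift_coeff v c m \<noteq> 0} = (\<lambda>m. m + mono_var v) ` {m. c m \<noteq> 0}"
    using Collect_shift_coeff[of "\<lambda>t. t \<noteq> 0"] by auto
  have "peval (shift_coeff v c) x = x v * peval c x" for x
    unfolding peval_def S
    by (subst sum.reindex) (auto simp: inj_on_def mono_eval_add sum_distrib_left mult_ac)
  moreover have "Poly_Mapping.keys m \<subseteq> {..<a + b} \<and> mono_degree m = d + 1"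
    if "shift_coeff v c m \<noteq> 0" for m
  proof -
    have "m \<in> (\<lambda>m. m + mono_var v) ` {m. c m \<noteq> 0}"
      using S that by (metis (mono_tags) mem_Collect_eq)
    then obtain m' where "m = m' + mono_var v" "c m' \<noteq> 0"
      by (rule imageE) simp
    then show ?thesis
      using assms by (auto simp: vanishing_form_def keys_add_nat mono_degree_add)
  qed
  ultimately show ?thesis
    using assms S by (auto simp: vanishing_form_def)
qed

text \<open>The added term is the coefficient function of \<open>\<gamma> \<mu> s\<close>, a
  multiple of \<open>s\<close>.\<close>

lemma vanishing_form_add_block:
  assumes c: "vanishing_form a b d c" and mu: "Poly_Mapping.keys \<mu> \<subseteq> {..<a + b}" "mono_degree \<mu> + 1 = d"
  shows "vanishing_form a b d
    (\<lambda>m. c m + \<gamma> * (\<Sum>j<a + b. if m = \<mu> + mono_var j then var_sign a j else 0))"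
    (is "vanishing_form a b d ?c'")
proof -
  define U where "U = {m. c m \<noteq> 0} \<union> (\<lambda>j. \<mu> + mono_var j) ` {..<a + b}"
  have U: "finite U" "{m. c m \<noteq> 0} \<subseteq> U"
    using c by (auto simp: U_def vanishing_form_def)
  have S: "{m. ?c' m \<noteq> 0} \<subseteq> U"
  proof
    fix m
    assume "m \<in> {m. ?c' m \<noteq> 0}"
    then have "c m \<noteq> 0 \<or> (\<Sum>j<a + b. if m = \<mu> + mono_var j then var_sign a j else 0) \<noteq> 0"
      by auto
    then show "m \<in> U"
      by (auto simp: U_def elim!: sum.not_neutral_contains_not_neutral split: if_splits)
  qed
  have "peval ?c' x = peval c x + \<gamma> * mono_eval \<mu> x * (\<Sum>j<a + b. var_sign a j * x j)" for x
  proof -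
    have "(\<Sum>m\<in>U. (\<Sum>j<a + b. if m = \<mu> + mono_var j then var_sign a j else 0) * mono_eval m x)
        = (\<Sum>j<a + b. \<Sum>m\<in>U. if m = \<mu> + mono_var j then var_sign a j * mono_eval m x else 0)"
      unfolding sum_distrib_right by (subst sum.swap) (intro sum.cong; auto)
    also have "\<dots> = (\<Sum>j<a + b. var_sign a j * mono_eval (\<mu> + mono_var j) x)"
      using U by (intro sum.cong) (auto simp: sum.delta U_def)
    also have "\<dots> = mono_eval \<mu> x * (\<Sum>j<a + b. var_sign a j * x j)"
      by (simp add: mono_eval_add sum_distrib_left mult_ac)
    finally show ?thesis
      unfolding peval_superset[OF U] peval_superset[OF U(1) S]
      by (simp add: distrib_right sum.distrib sum_distrib_left[symmetric] mult.assoc)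
  qed
  moreover have "Poly_Mapping.keys m \<subseteq> {..<a + b} \<and> mono_degree m = d" if "?c' m \<noteq> 0" for m
  proof -
    have "m \<in> U" using S that by blast
    then show ?thesis
      using c mu by (auto simp: U_def vanishing_form_def keys_add_nat mono_degree_add)
  qed
  ultimately show ?thesis
    using c S U(1) by (auto simp: vanishing_form_def intro: finite_subset)
qed

text \<open>
  If every monomial of \<open>c\<close> contains the last variable and \<open>\<mu>\<close> does not, then \<open>\<gamma> \<mu> s\<close> meets \<open>c\<close> at most
  in the monomial \<open>t\<close>, whose coefficient in \<open>\<gamma> \<mu> s\<close> is \<open>- \<gamma>\<close>.
\<close>

lemma signature_pair_add_block:
  assumes c: "vanishing_form a b d c" and ab: "1 \<le> a" "2 \<le> b"
    and div: "\<And>m. c m \<noteq> 0 \<Longrightarrow> Poly_Mapping.lookup m (a + b - 1) \<noteq> 0"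
    and mu: "Poly_Mapping.keys \<mu> \<subseteq> {..<a + b}" "mono_degree \<mu> + 1 = d"
      "Poly_Mapping.lookup \<mu> (a + b - 1) = 0"
    and \<gamma>: "\<gamma> > 0"
  defines "t \<equiv> \<mu> + mono_var (a + b - 1)"
  shows "signature_pair a b
    (card ({m. c m > 0} - {t}) + a + (if c t > \<gamma> then 1 else 0))
    (card ({m. c m < 0} - {t}) + (b - 1) + (if c t < \<gamma> then 1 else 0))"
proof -
  define v where "v = a + b - 1"
  have v: "a < v" "{..<a + b} = insert v {..<v}" "t = \<mu> + mono_var v"
    using ab by (auto simp: v_def t_def)
  define T where "T j = \<mu> + mono_var j" for j
  have T_eq: "T i = T j \<longleftrightarrow> i = j" for i j
    unfolding T_def by (metis One_nat_def add_left_cancel keys_single zero_neq_one singleton_inject)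
  have T_v: "Poly_Mapping.lookup (T j) v = 0" if "j \<noteq> v" for j
    using mu(3) that by (simp add: T_def v_def lookup_add lookup_single when_def)
  have cT: "c (T j) = 0" if "j \<noteq> v" for j
    using div T_v that v_def by blast
  define c' where "c' m = c m + \<gamma> * (\<Sum>j<a + b. if m = \<mu> + mono_var j then var_sign a j else 0)" for m
  have c'T: "c' (T j) = c (T j) + \<gamma> * var_sign a j" if "j < a + b" for j
  proof -
    have "(\<Sum>i<a + b. if T j = T i then var_sign a i else 0) = (\<Sum>i<a + b. if j = i then var_sign a i else 0)"
      by (simp add: T_eq)
    then show ?thesis
      using that by (simp add: c'_def T_def)
  qed
  have c'_other: "c' m = c m" if "m \<notin> T ` {..<a + b}" for m
  proof -
    have "(\<Sum>j<a + b. if m = \<mu> + mono_var j then var_sign a j else 0) = 0"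
      using that by (intro sum.neutral) (auto simp: T_def)
    then show ?thesis by (simp add: c'_def)
  qed
  have "vanishing_form a b d c'"
    unfolding c'_def using c mu by (intro vanishing_form_add_block) auto
  have c'p: "c' (T j) = \<gamma>" if "j < a" for j
    using c'T[of j] cT[of j] that v by (simp add: var_sign_def)
  have c'n: "c' (T j) = - \<gamma>" if "a \<le> j" "j < v" for j
    using c'T[of j] cT[of j] that v by (simp add: var_sign_def v_def)
  have c'v: "c' (T v) = c (T v) - \<gamma>"
    using c'T[of v] v ab by (simp add: var_sign_def v_def)
  have tv: "t = T v" by (simp add: v T_def)
  have split: "T ` {..<a + b} = T ` {..<a} \<union> T ` {a..<v} \<union> {t}"
  proof -
    have "{..<v} = {..<a} \<union> {a..<v}" using v(1) by auto
    then show ?thesis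
      unfolding v(2) tv by auto
  qed
  have cases4: "m \<notin> T ` {..<a + b} \<or> (\<exists>j<a. m = T j) \<or> (\<exists>j. a \<le> j \<and> j < v \<and> m = T j) \<or> m = T v" for m
    unfolding split tv by auto
  have fin: "finite {m. c m \<noteq> 0}" using c by (simp add: vanishing_form_def)
  have finp: "finite {m. c m > 0}"
    by (rule finite_subset[OF _ fin]) auto
  have finn: "finite {m. c m < 0}"
    by (rule finite_subset[OF _ fin]) auto
  have eqP: "{m. c' m > 0} = ({m. c m > 0} - {t}) \<union> T ` {..<a} \<union> (if c t > \<gamma> then {t} else {})" (is "_ = ?P")
  proof (rule set_eqI)
    fix m
    consider "m \<notin> T ` {..<a + b}" | j where "m = T j" "j < a" | j where "m = T j" "a \<le> j" "j < v" | "m = T v"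
      using cases4[of m] by blast
    then show "m \<in> {m. c' m > 0} \<longleftrightarrow> m \<in> ?P"
    proof cases
      case 1
      then show ?thesis using c'_other[of m] unfolding split by auto
    next
      case 2
      then show ?thesis using c'p[of j] \<gamma> v(1) cT[of j] by (auto simp: tv T_eq)
    next
      case 3
      then show ?thesis using c'n[of j] \<gamma> v(1) cT[of j] by (auto simp: tv T_eq)
    next
      case 4
      then show ?thesis using c'v v(1) by (auto simp: tv T_eq)
    qed
  qed
  have eqN: "{m. c' m < 0} = ({m. c m < 0} - {t}) \<union> T ` {a..<v} \<union> (if c t < \<gamma> then {t} else {})" (is "_ = ?N")
  proof (rule set_eqI)
    fix m
    consider "m \<notin> T ` {..<a + b}" | j where "m = T j" "j < a" | j where "m = T j" "a \<le> j" "j < v" | "m = T v"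
      using cases4[of m] by blast
    then show "m \<in> {m. c' m < 0} \<longleftrightarrow> m \<in> ?N"
    proof cases
      case 1
      then show ?thesis using c'_other[of m] unfolding split by auto
    next
      case 2
      then show ?thesis using c'p[of j] \<gamma> v(1) cT[of j] by (auto simp: tv T_eq)
    next
      case 3
      then show ?thesis using c'n[of j] \<gamma> v(1) cT[of j] by (auto simp: tv T_eq)
    next
      case 4
      then show ?thesis using c'v v(1) by (auto simp: tv T_eq)
    qed
  qed
  have injT: "inj_on T X" for X by (simp add: inj_on_def T_eq)
  have cardP: "card {m. c' m > 0} = card ({m. c m > 0} - {t}) + a + (if c t > \<gamma> then 1 else 0)"
  proof -
    have "card (({m. c m > 0} - {t}) \<union> T ` {..<a}) = card ({m. c m > 0} - {t}) + a"
      using finp v(1) cT by (subst card_Un_disjoint) (auto simp: card_image[OF injT])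
    moreover have "t \<notin> ({m. c m > 0} - {t}) \<union> T ` {..<a}"
      using v(1) by (auto simp: tv T_eq)
    ultimately show ?thesis
      unfolding eqP using finp by simp
  qed
  have cardN: "card {m. c' m < 0} = card ({m. c m < 0} - {t}) + (b - 1) + (if c t < \<gamma> then 1 else 0)"
  proof -
    have "v - a = b - 1" using ab by (simp add: v_def)
    then have "card (({m. c m < 0} - {t}) \<union> T ` {a..<v}) = card ({m. c m < 0} - {t}) + (b - 1)"
      using finn v(1) cT by (subst card_Un_disjoint) (auto simp: card_image[OF injT])
    moreover have "t \<notin> ({m. c m < 0} - {t}) \<union> T ` {a..<v}"
      using v(1) by (auto simp: tv T_eq)
    ultimately show ?thesis
      unfolding eqN using finn by simp
  qed
  \<comment> \<open>The new block restores the invariant for both signs: \<open>b \<ge> 2\<close>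
    gives \<open>a < v\<close>, so \<open>T a\<close> is a negative monomial free of the last
    variable.\<close>
  have "c' (T 0) > 0 \<and> Poly_Mapping.lookup (T 0) (a + b - 1) = 0"
    using c'p[of 0] T_v[of 0] ab \<gamma> v by (simp add: v_def)
  moreover have "c' (T a) < 0 \<and> Poly_Mapping.lookup (T a) (a + b - 1) = 0"
    using c'n[of a] T_v[of a] ab \<gamma> v by (simp add: v_def)
  ultimately show ?thesis
    unfolding signature_pair_def
    using \<open>vanishing_form a b d c'\<close> cardP cardN by (intro exI[of _ d] exI[of _ c']) blast
qed

section \<open>Signature pairs reached by adding blocks\<close>

lemma signature_pair_base:
  assumes "1 \<le> a" "2 \<le> b"
  shows "signature_pair a b a b"
proof -
  \<comment> \<open>Adding the block with \<open>\<mu> = 0\<close> and \<open>\<gamma> = 1\<close>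
    to the zero form gives \<open>s\<close> itself.\<close>
  have "vanishing_form a b 1 (\<lambda>_. 0)"
    by (simp add: vanishing_form_def peval_def)
  from signature_pair_add_block[OF this assms, of 0 1] show ?thesis
    using assms by simp
qed

lemma signature_pair_swap:
  assumes "signature_pair a b A B"
  shows "signature_pair a b B A"
proof -
  obtain d c where *: "vanishing_form a b d c" "card {m. c m > 0} = A" "card {m. c m < 0} = B"
      "\<exists>m. c m > 0 \<and> Poly_Mapping.lookup m (a + b - 1) = 0"
      "\<exists>m. c m < 0 \<and> Poly_Mapping.lookup m (a + b - 1) = 0"
    using assms unfolding signature_pair_def by blast
  have "vanishing_form a b d (\<lambda>m. - c m)"
    using *(1) by (simp add: vanishing_form_def peval_def sum_negf)
  then show ?thesis
    using * unfolding signature_pair_def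
    by (intro exI[of _ d] exI[of _ "\<lambda>m. - c m"]) auto
qed

text \<open>In \<open>v f\<close> the monomial \<open>\<mu> v\<close> has coefficient
  \<open>c \<mu>\<close>, from which the block subtracts \<open>\<gamma>\<close>: equality cancels
  it, half of \<open>c \<mu>\<close> leaves it positive, twice \<open>c \<mu>\<close> makes it
  negative.\<close>

lemma signature_pair_step:
  assumes AB: "signature_pair a b A B" and ab: "1 \<le> a" "2 \<le> b" and ij: "i \<le> 1" "j \<le> 1"
  shows "signature_pair a b (A + (a - 1) + i) (B + (b - 1) + j)"
proof -
  define v where "v = a + b - 1"
  have v: "v < a + b" "0 < v" using ab by (auto simp: v_def)
  obtain d c \<mu> where c: "vanishing_form a b d c" "card {m. c m > 0} = A" "card {m. c m < 0} = B"
    and mu: "c \<mu> > 0" "Poly_Mapping.lookup \<mu> v = 0"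
    using AB unfolding signature_pair_def v_def by blast
  have fin: "finite {m. c m \<noteq> 0}" using c by (simp add: vanishing_form_def)
  have "finite {m. c m > 0}"
    by (rule finite_subset[OF _ fin]) auto
  moreover have "{m. c m > 0} \<noteq> {}"
    using mu by blast
  ultimately have "A \<noteq> 0"
    unfolding c(2)[symmetric] by simp
  define c1 where "c1 = shift_coeff v c"
  have c1: "vanishing_form a b (d + 1) c1" "card {m. c1 m > 0} = A" "card {m. c1 m < 0} = B"
    using vanishing_form_shift[OF c(1)] v c card_shift_coeff[of "\<lambda>t. t > 0"] card_shift_coeff[of "\<lambda>t. t < 0"]
    by (auto simp: c1_def)
  have div1: "c1 m \<noteq> 0 \<Longrightarrow> Poly_Mapping.lookup m v \<noteq> 0" for m
    by (auto simp: c1_def shift_coeff_def split: if_splits)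
  have c1t: "c1 (\<mu> + mono_var v) = c \<mu>"
    by (simp add: c1_def)
  then have cards: "card ({m. c1 m > 0} - {\<mu> + mono_var v}) = A - 1"
      "card ({m. c1 m < 0} - {\<mu> + mono_var v}) = B"
    using mu c1 by (simp_all add: card_Diff_singleton_if)
  have mu': "Poly_Mapping.keys \<mu> \<subseteq> {..<a + b}" "mono_degree \<mu> + 1 = d + 1"
    using c(1) mu by (auto simp: vanishing_form_def)
  have blk: "signature_pair a b (A - 1 + a + (if c \<mu> > \<gamma> then 1 else 0)) (B + (b - 1) + (if c \<mu> < \<gamma> then 1 else 0))"
    if "\<gamma> > 0" for \<gamma>
    using signature_pair_add_block[OF c1(1) ab div1[unfolded v_def] mu' mu(2)[unfolded v_def] that]
    unfolding v_def[symmetric] cards c1t .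
  consider "i = 0" "j = 0" | "i = 1" "j = 0" | "i = 0" "j = 1" | "i = 1" "j = 1"
    using ij by linarith
  then show ?thesis
  proof cases
    case 1
    then show ?thesis using blk[of "c \<mu>"] mu ab \<open>A \<noteq> 0\<close> by simp
  next
    case 2
    then show ?thesis using blk[of "c \<mu> / 2"] mu ab \<open>A \<noteq> 0\<close> by simp
  next
    case 3
    then show ?thesis using blk[of "2 * c \<mu>"] mu ab \<open>A \<noteq> 0\<close> by simp
  next
    case 4
    define c2 where "c2 = shift_coeff v c1"
    have c2: "vanishing_form a b (d + 2) c2" "card {m. c2 m > 0} = A" "card {m. c2 m < 0} = B"
      using vanishing_form_shift[OF c1(1)] v c1 card_shift_coeff[of "\<lambda>t. t > 0"] card_shift_coeff[of "\<lambda>t. t < 0"]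
      by (auto simp: c2_def)
    have div2: "c2 m \<noteq> 0 \<Longrightarrow> Poly_Mapping.lookup m v \<noteq> 0" for m
      by (auto simp: c2_def shift_coeff_def split: if_splits)
    \<comment> \<open>A power of variable 0, which is not the last one. A collision at
      \<open>\<nu> v\<close> in \<open>v^2 f\<close> would need \<open>\<nu>\<close> to occur in
      \<open>v f\<close>, all of whose monomials contain \<open>v\<close>.\<close>
    define \<nu> where "\<nu> = (Poly_Mapping.single 0 (d + 1) :: nat \<Rightarrow>\<^sub>0 nat)"
    have nu: "Poly_Mapping.keys \<nu> \<subseteq> {..<a + b}" "mono_degree \<nu> + 1 = d + 2" "Poly_Mapping.lookup \<nu> v = 0"
      using v by (auto simp: \<nu>_def lookup_single when_def)
    have c2t: "c2 (\<nu> + mono_var v) = 0"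
      using div1[of \<nu>] nu by (auto simp: c2_def)
    then have cards2: "card ({m. c2 m > 0} - {\<nu> + mono_var v}) = A"
        "card ({m. c2 m < 0} - {\<nu> + mono_var v}) = B"
      using c2 by (simp_all add: card_Diff_singleton_if)
    show ?thesis
      using signature_pair_add_block[OF c2(1) ab div2[unfolded v_def] nu(1,2) nu(3)[unfolded v_def], of 1]
      unfolding v_def[symmetric] cards2 c2t using 4 ab by simp
  qed
qed

text \<open>Induction on the number of blocks. The first block realizes offsets 0, and each further
  one adds 0 or 1 to each offset independently. A negative block is a positive one between two sign
  changes.\<close>

lemma signature_pair_box:
  assumes ab: "1 \<le> a" "2 \<le> b"
    and "k + l = Suc n" "i \<le> n" "j \<le> n"
  shows "signature_pair a b ((a - 1) * k + (b - 1) * l + 1 + i) ((b - 1) * k + (a - 1) * l + 1 + j)"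
  using assms(3-)
proof (induction n arbitrary: k l i j)
  case 0
  then consider "k = 1" "l = 0" | "k = 0" "l = 1" by linarith
  then show ?case
    using 0 ab signature_pair_base[OF ab] signature_pair_swap[OF signature_pair_base[OF ab]]
    by cases auto
next
  case (Suc n)
  \<comment> \<open>By truncated subtraction the share \<open>i - i'\<close> of the last block is 0
    for \<open>i = 0\<close> and 1 otherwise.\<close>
  define i' j' where "i' = i - 1" and "j' = j - 1"
  define i'' j'' where "i'' = i - i'" and "j'' = j - j'"
  have ij: "i = i' + i''" "j = j' + j''" "i'' \<le> 1" "j'' \<le> 1" "i' \<le> n" "j' \<le> n"
    using Suc.prems by (auto simp: i'_def j'_def i''_def j''_def)
  show ?case
  proof (cases k)
    case (Suc k')
    then have "signature_pair a b ((a - 1) * k' + (b - 1) * l + 1 + i') ((b - 1) * k' + (a - 1) * l + 1 + j')"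
      using Suc.IH Suc.prems ij by simp
    from signature_pair_step[OF this ab ij(3,4)] show ?thesis
      unfolding Suc ij(1,2) by (simp add: add_ac)
  next
    case 0
    then obtain l' where l: "l = Suc l'" "l' = Suc n"
      using Suc.prems by (cases l) auto
    then have "signature_pair a b ((b - 1) * l' + 1 + i') ((a - 1) * l' + 1 + j')"
      using Suc.IH[of 0 l' i' j'] ij by simp
    from signature_pair_swap[OF signature_pair_step[OF signature_pair_swap[OF this] ab ij(4,3)]] show ?thesis
      unfolding 0 l(1) ij(1,2) by (simp add: add_ac)
  qed
qed

lemma signature_pair_exists:
  fixes a b A B :: nat
  assumes "2 \<le> b" "b \<le> a" "a * (a + b - 2) + 1 \<le> A + B"
    and "(b - 1) * A + a * (b - 1) \<le> a * B" "(b - 1) * B + a * (b - 1) \<le> a * A"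
  shows "signature_pair a b A B"
proof -
  have "1 \<le> b - 1" "b - 1 \<le> a - 1" "(a - 1) + 1 = a" "(b - 1) + 1 = b" "(a - 1) + (b - 1) = a + b - 2"
    using assms by auto
  then obtain k l where kl: "(a - 1) * k + (b - 1) * l + 1 \<le> A" "A \<le> a * k + b * l"
      "(b - 1) * k + (a - 1) * l + 1 \<le> B" "B \<le> b * k + a * l"
    using covering[of "b - 1" "a - 1" A B] assms by auto
  then have "k + l \<noteq> 0" by (auto intro: ccontr)
  then obtain n where n: "k + l = Suc n" by (cases "k + l") auto
  obtain a' b' where ab': "a = Suc a'" "b = Suc b'"
    using assms by (cases a; cases b) auto
  \<comment> \<open>The square has side \<open>k + l = Suc n\<close>, so the offsets of
    \<open>A\<close> and \<open>B\<close> from its lowest corner are at most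
    \<open>n\<close>.\<close>
  show ?thesis
    using signature_pair_box[of a b k l n "A - ((a - 1) * k + (b - 1) * l + 1)" "B - ((b - 1) * k + (a - 1) * l + 1)"]
      assms kl n by (simp add: ab')
qed


section \<open>Linear functionals, characters and evaluation of polynomials\<close>

lemma sum_fun_apply: "(\<Sum>i\<in>I. f i) x = (\<Sum>i\<in>I. f i x)"
  by (induction I rule: infinite_finite_induct) auto

text \<open>Some unit vector \<open>e k\<close> with \<open>k < n\<close> lies outside
  \<open>V\<close>. A linear functional that is 1 on it and 0 on a basis of \<open>V\<close> has
  coefficients \<open>g (e j)\<close>, and the one at \<open>k\<close> is nonzero.\<close>

lemma cspace_functional:
  assumes "V \<subseteq> cspace n" "cfun.subspace V" "cfun.dim V < n"
  shows "\<exists>c :: nat \<Rightarrow> complex. (\<exists>j<n. c j \<noteq> 0) \<and> (\<forall>v\<in>V. (\<Sum>j<n. c j * v j) = 0)"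
proof -
  define e :: "nat \<Rightarrow> nat \<Rightarrow> complex" where "e j = (\<lambda>i. if i = j then 1 else 0)" for j
  have decomp: "v = (\<Sum>j<n. (\<lambda>i. v j * e j i))" if "v \<in> cspace n" for v
    using that by (auto simp: fun_eq_iff sum_fun_apply e_def cspace_def not_less if_distrib cong: if_cong)
  have e_app: "e j i = (if i = j then 1 else 0)" for i j
    by (simp add: e_def)
  have inj: "inj_on e X" for X
    by (auto simp: inj_on_def e_def fun_eq_iff)
  have "\<exists>j<n. e j \<notin> V"
  proof (rule ccontr)
    assume "\<not> (\<exists>j<n. e j \<notin> V)"
    then have eV: "e ` {..<n} \<subseteq> V" by auto
    have "cfun.independent (e ` {..<n})"
    proof -
      have "u x = 0" if u: "(\<Sum>v\<in>e ` {..<n}. (\<lambda>i. u v * v i)) = 0" and x: "x \<in> e ` {..<n}" for u x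
      proof -
        obtain k where k: "k < n" "x = e k" using x by auto
        have "(\<Sum>j<n. (\<lambda>i. u (e j) * e j i)) k = 0"
          using u by (simp add: sum.reindex[OF inj] o_def)
        then show ?thesis
          using k by (simp add: sum_fun_apply e_app if_distrib cong: if_cong)
      qed
      then show ?thesis
        by (subst cfun.dependent_finite) auto
    qed
    moreover have "cfun.span (e ` {..<n}) = cfun.span V"
    proof (rule antisym)
      show "cfun.span (e ` {..<n}) \<subseteq> cfun.span V" using eV by (rule cfun.span_mono)
      have "v \<in> cfun.span (e ` {..<n})" if "v \<in> cspace n" for v
        by (subst decomp[OF that], intro cfun.span_sum cfun.span_scale cfun.span_base) auto
      then show "cfun.span V \<subseteq> cfun.span (e ` {..<n})"
        using assms by (intro cfun.span_minimal) auto
    qed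
    ultimately have "cfun.dim V = card (e ` {..<n})"
      by (intro cfun.dim_eq_card) auto
    then show False
      using assms by (simp add: card_image[OF inj])
  qed
  then obtain k where k: "k < n" "e k \<notin> V" by blast
  obtain B where B: "B \<subseteq> V" "cfun.independent B" "V \<subseteq> cfun.span B"
    using cfun.maximal_independent_subset by blast
  have "cfun.span B = V"
    using B assms by (metis cfun.span_subspace)
  then have ind: "cfun.independent (insert (e k) B)"
    using k B by (intro cfun.independent_insertI) auto
  interpret vp: vector_space_pair "\<lambda>(c :: complex) (v :: nat \<Rightarrow> complex) i. c * v i" "\<lambda>(c :: complex) v. c * v"
    by unfold_locales (auto simp: algebra_simps)
  obtain g where g: "Vector_Spaces.linear (\<lambda>c v i. c * v i) (*) g"
    "\<forall>x \<in> insert (e k) B. g x = (if x = e k then 1 else 0)"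
    using vp.linear_independent_extend[OF ind, of "\<lambda>x. if x = e k then 1 else 0"] by blast
  have gB: "g x = 0" if "x \<in> B" for x
    using g(2) that k(2) B(1) by (metis insertI2 subsetD)
  have g0: "g v = 0" if "v \<in> V" for v
  proof -
    have "v \<in> cfun.span B"
      using B(3) that by (rule subsetD)
    then show ?thesis
      using vp.linear_eq_0_on_span[OF g(1) gB] by simp
  qed
  have gv: "g v = (\<Sum>j<n. g (e j) * v j)" if "v \<in> cspace n" for v
  proof -
    have "g v = g (\<Sum>j<n. (\<lambda>i. v j * e j i))" using decomp[OF that] by simp
    also have "\<dots> = (\<Sum>j<n. v j * g (e j))"
      by (simp add: vp.linear_sum[OF g(1)] vp.linear_scale[OF g(1)])
    finally show ?thesis by (simp add: mult.commute)
  qed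
  show ?thesis
  proof (intro exI[of _ "\<lambda>j. g (e j)"] conjI ballI)
    show "\<exists>j<n. g (e j) \<noteq> 0"
      using k(1) g(2) by (intro exI[of _ k]) simp
    show "(\<Sum>j<n. g (e j) * v j) = 0" if "v \<in> V" for v
      using gv[of v] g0[OF that] assms(1) that by auto
  qed
qed

text \<open>Artin's argument: the relation at \<open>mul g h\<close> minus
  \<open>\<chi> i0 h\<close> times the relation at \<open>g\<close> eliminates \<open>i0\<close>,
  and an \<open>h\<close> separating \<open>i\<close> from \<open>i0\<close> gives
  \<open>k i = 0\<close>.\<close>

lemma characters_independent:
  fixes \<chi> :: "'i \<Rightarrow> 'g \<Rightarrow> 'k::field" and mul :: "'g \<Rightarrow> 'g \<Rightarrow> 'g"
  assumes "finite S" "\<And>g h. g \<in> G \<Longrightarrow> h \<in> G \<Longrightarrow> mul g h \<in> G"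
    and "\<And>i g h. i \<in> S \<Longrightarrow> \<chi> i (mul g h) = \<chi> i g * \<chi> i h"
    and "\<And>i. i \<in> S \<Longrightarrow> \<exists>g\<in>G. \<chi> i g \<noteq> 0"
    and "\<And>i j. i \<in> S \<Longrightarrow> j \<in> S \<Longrightarrow> i \<noteq> j \<Longrightarrow> \<exists>g\<in>G. \<chi> i g \<noteq> \<chi> j g"
    and "\<And>g. g \<in> G \<Longrightarrow> (\<Sum>i\<in>S. k i * \<chi> i g) = 0"
  shows "\<forall>i\<in>S. k i = 0"
  using assms(1,3-)
proof (induction S arbitrary: k rule: finite_induct)
  case (insert i0 S)
  have "k i = 0" if i: "i \<in> S" for i
  proof -
    have "i \<noteq> i0"
      using insert.hyps i by blast
    then obtain h where h: "h \<in> G" "\<chi> i h \<noteq> \<chi> i0 h"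
      using insert.prems(3)[of i i0] i by auto
    have "\<forall>i\<in>S. k i * (\<chi> i h - \<chi> i0 h) = 0"
    proof (rule insert.IH)
      fix g
      assume "g \<in> G"
      then have "(\<Sum>i\<in>insert i0 S. k i * \<chi> i (mul g h)) - \<chi> i0 h * (\<Sum>i\<in>insert i0 S. k i * \<chi> i g) = 0"
        using insert.prems(4) assms(2) h by simp
      also have "(\<Sum>i\<in>insert i0 S. k i * \<chi> i (mul g h)) = (\<Sum>i\<in>insert i0 S. k i * (\<chi> i g * \<chi> i h))"
        using insert.prems(1) by (intro sum.cong) auto
      finally show "(\<Sum>i\<in>S. k i * (\<chi> i h - \<chi> i0 h) * \<chi> i g) = 0"
        using insert.hyps by (simp add: sum_subtractf sum_distrib_left algebra_simps)
    qed (use insert.prems in auto)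
    then show ?thesis
      using i h by auto
  qed
  moreover from this have "k i0 = 0"
    using insert.prems(2)[of i0] insert.prems(4) insert.hyps by fastforce
  ultimately show ?case by auto
qed auto

section \<open>Evaluation of polynomials and monomials\<close>

lemma poly_eval_superset:
  assumes "finite U" "Poly_Mapping.keys p \<subseteq> U"
  shows "poly_eval p z = (\<Sum>m\<in>U. Poly_Mapping.lookup p m * mono_eval m z)"
  unfolding poly_eval_def mono_eval_def using assms
  by (intro sum.mono_neutral_left) (auto simp: not_in_keys_iff_lookup_eq_zero)

lemma poly_eval_single [simp]: "poly_eval (Poly_Mapping.single m c) z = c * mono_eval m z"
  by (subst poly_eval_superset[of "{m}"]) (auto simp: lookup_single)

lemma poly_eval_add: "poly_eval (p + q) z = poly_eval p z + poly_eval q z"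
proof -
  let ?U = "Poly_Mapping.keys p \<union> Poly_Mapping.keys q"
  have "Poly_Mapping.keys (p + q) \<subseteq> ?U" by (rule keys_add)
  then show ?thesis
    by (simp add: poly_eval_superset[of ?U] lookup_add distrib_right sum.distrib)
qed

lemma poly_eval_zero [simp]: "poly_eval 0 z = 0"
  by (simp add: poly_eval_def)

lemma poly_eval_sum: "poly_eval (\<Sum>i\<in>I. f i) z = (\<Sum>i\<in>I. poly_eval (f i) z)"
  by (induction I rule: infinite_finite_induct) (auto simp: poly_eval_add)

lemma poly_mapping_sum_singles:
  "p = (\<Sum>m\<in>Poly_Mapping.keys p. Poly_Mapping.single m (Poly_Mapping.lookup p m))"
  by (rule poly_mapping_eqI) (auto simp: lookup_sum lookup_single when_def in_keys_iff)

text \<open>Monomial factors suffice, since cross-multiplication below is with components of a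
  monomial map.\<close>

lemma poly_eval_mult_single:
  "poly_eval (p * Poly_Mapping.single m c) z = poly_eval p z * (c * mono_eval m z)"
proof -
  have "p * Poly_Mapping.single m c
      = (\<Sum>k\<in>Poly_Mapping.keys p. Poly_Mapping.single (k + m) (Poly_Mapping.lookup p k * c))"
    by (subst poly_mapping_sum_singles[of p]) (simp add: sum_distrib_right mult_single)
  then show ?thesis
    by (simp add: poly_eval_sum mono_eval_add poly_eval_superset[of "Poly_Mapping.keys p"]
        sum_distrib_left mult_ac)
qed

lemma tendsto_poly_eval:
  assumes "\<And>i. ((\<lambda>t. f t i) \<longlongrightarrow> z i) F"
  shows "((\<lambda>t. poly_eval p (f t)) \<longlongrightarrow> poly_eval p z) F"
  unfolding poly_eval_def by (intro tendsto_intros assms)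

lemma mono_eval_mult: "mono_eval m (\<lambda>i. x i * y i) = mono_eval m x * mono_eval m y"
  by (simp add: mono_eval_def power_mult_distrib prod.distrib)

lemma mono_eval_update:
  "mono_eval (Poly_Mapping.update k 0 m) (z :: nat \<Rightarrow> complex) = mono_eval m (z(k := 1))"
proof -
  let ?K = "insert k (Poly_Mapping.keys m)"
  have "Poly_Mapping.keys (Poly_Mapping.update k 0 m) \<subseteq> ?K"
    by (auto simp: in_keys_iff lookup_update split: if_splits)
  then show ?thesis
    by (simp add: mono_eval_superset[of ?K] subset_insertI lookup_update del: prod.insert)
      (intro prod.cong; auto simp: lookup_update)
qed

lemma mono_eval_nonzero:
  fixes z :: "nat \<Rightarrow> 'a::field"
  assumes "\<And>i. i \<in> Poly_Mapping.keys m \<Longrightarrow> z i \<noteq> 0"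
  shows "mono_eval m z \<noteq> 0"
  using assms by (auto simp: mono_eval_def)

text \<open>The bridge from identities in \<open>x_j = |z_j|^2\<close> to Hermitian norms.\<close>

lemma norm_mono_eval: "(cmod (mono_eval m z))\<^sup>2 = mono_eval m (\<lambda>i. (cmod (z i))\<^sup>2)"
  by (simp add: mono_eval_def prod_norm[symmetric] norm_power prod_power_distrib power_mult[symmetric] mult.commute)

section \<open>The Hermitian form\<close>

lemma herm_alt: "herm a b z = (\<Sum>j<a + b. var_sign a j * (cmod (z j))\<^sup>2)"
proof -
  have "{..<a + b} = {..<a} \<union> {a..<a + b}" by auto
  then have "(\<Sum>j<a + b. var_sign a j * (cmod (z j))\<^sup>2)
      = (\<Sum>j<a. var_sign a j * (cmod (z j))\<^sup>2) + (\<Sum>j=a..<a + b. var_sign a j * (cmod (z j))\<^sup>2)"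
    by (simp add: sum.union_disjoint ivl_disj_int)
  then show ?thesis
    by (simp add: herm_def var_sign_def sum_negf)
qed

lemma herm_cong: "(\<And>j. j < a + b \<Longrightarrow> cmod (z j) = cmod (w j)) \<Longrightarrow> herm a b z = herm a b w"
  unfolding herm_alt by (intro sum.cong) auto

lemma herm_scale: "herm a b (\<lambda>j. c * z j) = (cmod c)\<^sup>2 * herm a b z"
  by (simp add: herm_alt norm_mult power_mult_distrib sum_distrib_left mult_ac)

lemma herm_Suc: "herm a (Suc b) z = herm a b z - (cmod (z (a + b)))\<^sup>2"
  by (simp add: herm_alt var_sign_def)

lemma tendsto_herm:
  assumes "\<And>j. j < a + b \<Longrightarrow> ((\<lambda>t. f t j) \<longlongrightarrow> z j) F"
  shows "((\<lambda>t. herm a b (f t)) \<longlongrightarrow> herm a b z) F"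
  unfolding herm_alt using assms by (intro tendsto_intros) auto


section \<open>Monomial maps of hyperquadrics\<close>

text \<open>A vanishing form listed by its monomials, the \<open>A\<close> positive ones first;
  \<open>r j\<close> is the square root of the absolute value of a coefficient.\<close>

locale monomial_map =
  fixes a b A B d :: nat and \<mu> :: "nat \<Rightarrow> (nat \<Rightarrow>\<^sub>0 nat)" and r :: "nat \<Rightarrow> real"
  assumes a_pos: "1 \<le> a" and b_pos: "1 \<le> b" and B_pos: "1 \<le> B"
    and keys_mu: "j < A + B \<Longrightarrow> Poly_Mapping.keys (\<mu> j) \<subseteq> {..<a + b}"
    and degree_mu: "j < A + B \<Longrightarrow> mono_degree (\<mu> j) = d"
    and r_pos: "j < A + B \<Longrightarrow> 0 < r j"
    and inj_mu: "inj_on \<mu> {..<A + B}"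
    and vanish: "(\<Sum>i<a + b. var_sign a i * x i) = 0 \<Longrightarrow>
      (\<Sum>j<A + B. var_sign A j * ((r j)\<^sup>2 * mono_eval (\<mu> j) x)) = 0"
begin

definition F :: "nat \<Rightarrow> cpoly" where
  "F j = Poly_Mapping.single (\<mu> j) (complex_of_real (r j))"

text \<open>\<open>v\<close> and \<open>w\<close> are each both the index of the last coordinate and
  the dimension of the affine space after dehomogenization.\<close>

definition v :: nat where "v = a + (b - 1)"

definition w :: nat where "w = A + (B - 1)"

lemma v_eq: "a + b - 1 = v" "a + b = Suc v"
  using b_pos by (auto simp: v_def)

lemma w_eq: "A + B - 1 = w" "A + B = Suc w"
  using B_pos by (auto simp: w_def)

lemma poly_eval_F: "poly_eval (F j) z = complex_of_real (r j) * mono_eval (\<mu> j) z"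
  by (simp add: F_def)

lemma herm_F:
  assumes "herm a b z = 0"
  shows "herm A B (\<lambda>j. poly_eval (F j) z) = 0"
  using vanish[of "\<lambda>i. (cmod (z i))\<^sup>2"] assms
  by (simp add: herm_alt poly_eval_F norm_mult power_mult_distrib norm_mono_eval)

lemma homogeneous_poly_mapping_F: "homogeneous_poly_mapping_HQ a b A B F"
proof -
  have "F j \<in> polys_in (a + b)" if "j < A + B" for j
    using keys_mu[OF that] by (auto simp: F_def polys_in_def split: if_splits)
  moreover have "homogeneous_of_degree d (F j)" if "j < A + B" for j
    using degree_mu[OF that] by (auto simp: F_def homogeneous_of_degree_def mono_degree_def split: if_splits)
  moreover have "poly_map_eval (A + B) F z \<in> HQ A B" if "z \<in> HQ a b" for z
  proof -
    have "herm A B (poly_map_eval (A + B) F z) = herm A B (\<lambda>j. poly_eval (F j) z)"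
      by (rule herm_cong) (simp add: poly_map_eval_def)
    then show ?thesis
      using herm_F that by (auto simp: HQ_def cspace_def poly_map_eval_def)
  qed
  ultimately show ?thesis
    unfolding homogeneous_poly_mapping_HQ_def by blast
qed

lemma lin_indep_F: "lin_indep_components (A + B) F"
  unfolding lin_indep_components_def
proof (intro allI impI)
  fix c :: "nat \<Rightarrow> complex" and k
  assume 0: "(\<Sum>j<A + B. Poly_Mapping.single 0 (c j) * F j) = 0" and k: "k < A + B"
  have "0 = Poly_Mapping.lookup (\<Sum>j<A + B. Poly_Mapping.single 0 (c j) * F j) (\<mu> k)"
    using 0 by simp
  also have "\<dots> = (\<Sum>j<A + B. if j = k then c k * r k else 0)"
    unfolding lookup_sum using inj_mu k
    by (intro sum.cong) (auto simp: F_def mult_single lookup_single when_def inj_on_def)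
  also have "\<dots> = c k * r k"
    using k by simp
  finally show "c k = 0"
    using r_pos[OF k] by simp
qed

section \<open>The dehomogenized map\<close>

abbreviation R :: "nat \<Rightarrow> cpoly fract" where
  "R \<equiv> dehomogenization (a + b) (A + B) F"

text \<open>\<open>P j\<close> is \<open>F j\<close> with the last variable set to \<open>1\<close>.\<close>

definition P :: "nat \<Rightarrow> cpoly" where
  "P j = Poly_Mapping.single (Poly_Mapping.update v 0 (\<mu> j)) (complex_of_real (r j))"

lemma R_eq: "j < A + B \<Longrightarrow> R j = Fract (P j) (P w)"
  using r_pos[of j] r_pos[of w] w_eq v_eq
  by (simp add: dehomogenization_def F_def P_def set_var_one_def)

lemma P_nonzero: "j < A + B \<Longrightarrow> P j \<noteq> 0"
  using r_pos[of j] by (metis P_def lookup_single_eq lookup_zero of_real_eq_0_iff order_less_irrefl)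

lemma P_polys_in: "j < A + B \<Longrightarrow> P j \<in> polys_in v"
  using keys_mu[of j] v_eq
  by (auto simp: P_def polys_in_def keys_update split: if_splits)

lemma poly_eval_P: "poly_eval (P j) z = poly_eval (F j) (z(v := 1))"
  by (simp add: P_def F_def mono_eval_update)

lemma poly_eval_F_nonzero:
  assumes "j < A + B" "\<And>i. i \<le> v \<Longrightarrow> z i \<noteq> 0"
  shows "poly_eval (F j) z \<noteq> 0"
proof -
  have "i \<le> v" if "i \<in> Poly_Mapping.keys (\<mu> j)" for i
    using keys_mu[OF assms(1)] that v_eq by auto
  then show ?thesis
    using r_pos[OF assms(1)] assms(2) mono_eval_nonzero[of "\<mu> j" z] by (simp add: poly_eval_F)
qed

definition image_coord :: "nat \<Rightarrow> (nat \<Rightarrow> complex) \<Rightarrow> complex" where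
  "image_coord j z = poly_eval (P j) z / poly_eval (P w) z"

lemma poly_eval_P_nonzero:
  assumes "j < A + B" "\<And>i. i < v \<Longrightarrow> z i \<noteq> 0"
  shows "poly_eval (P j) z \<noteq> 0"
  unfolding poly_eval_P using assms by (intro poly_eval_F_nonzero) auto

text \<open>Appending the coordinate 1 lifts \<open>z\<close> to the cone
  \<open>herm a b = 0\<close>. The image lies in the target cone, and dividing by its last
  coordinate normalizes the form to 1.\<close>

lemma herm_image_coord:
  assumes "z \<in> Q a (b - 1)" "\<And>i. i < v \<Longrightarrow> z i \<noteq> 0"
  shows "herm A (B - 1) (\<lambda>j. image_coord j z) = 1"
proof -
  define y where "y j = poly_eval (P j) z" for j
  have "herm a (b - 1) (z(v := 1)) = herm a (b - 1) z"
    by (rule herm_cong) (simp add: v_def)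
  then have "herm a b (z(v := 1)) = 0"
    using assms(1) herm_Suc[of a "b - 1"] b_pos by (simp add: Q_def v_def)
  then have "herm A B y = 0"
    using herm_F[of "z(v := 1)"] by (simp add: y_def[abs_def] poly_eval_P)
  then have y: "herm A (B - 1) y = (cmod (y w))\<^sup>2"
    using herm_Suc[of A "B - 1" y] B_pos by (simp add: w_def)
  have "y w \<noteq> 0"
    using poly_eval_P_nonzero[of w z] assms(2) w_eq by (simp add: y_def)
  have "herm A (B - 1) (\<lambda>j. image_coord j z) = herm A (B - 1) (\<lambda>j. inverse (y w) * y j)"
    by (rule herm_cong) (simp add: image_coord_def y_def norm_divide norm_mult norm_inverse divide_inverse)
  also have "\<dots> = (cmod (inverse (y w)))\<^sup>2 * (cmod (y w))\<^sup>2"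
    by (simp only: herm_scale y)
  also have "\<dots> = 1"
    using \<open>y w \<noteq> 0\<close> by (simp add: norm_inverse power_inverse)
  finally show ?thesis .
qed

text \<open>Cross-multiplying \<open>p / q = P j / P w\<close> and evaluating shows that any
  representation, reduced or not, has this value where no coordinate vanishes.\<close>

lemma image_coord_unique:
  assumes "R j = Fract p q" "j < A + B" "poly_eval q z' \<noteq> 0"
    and "poly_eval q z \<noteq> 0" "\<And>i. i < v \<Longrightarrow> z i \<noteq> 0"
  shows "poly_eval p z / poly_eval q z = image_coord j z"
proof -
  have "q \<noteq> 0" using assms(3) by auto
  then have "q * P j = p * P w"
    using assms(1,2) R_eq P_nonzero[of w] w_eq by (simp add: eq_fract mult.commute)
  then have "poly_eval (q * P j) z = poly_eval (p * P w) z" by simp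
  then have "poly_eval q z * poly_eval (P j) z = poly_eval p z * poly_eval (P w) z"
    by (simp add: P_def poly_eval_mult_single)
  moreover have "poly_eval (P w) z \<noteq> 0"
    using poly_eval_P_nonzero[of w z] assms(5) w_eq by simp
  ultimately show ?thesis
    using assms(4) by (simp add: image_coord_def frac_eq_eq mult.commute)
qed

text \<open>
  A component can be regular at a point where the monomial denominator vanishes, so such a point \<open>z\<close>
  is approached by points \<open>\<zeta> t\<close> of the hyperquadric without zero coordinates: the zeros of \<open>z\<close> are
  replaced by \<open>t\<close>, and the result is rescaled.
\<close>

lemma rational_CR_mapping_R: "rational_CR_mapping_Q a (b - 1) A (B - 1) R"
  unfolding rational_CR_mapping_Q_def v_def[symmetric] w_def[symmetric]
proof (intro conjI allI impI subsetI)
  fix j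
  assume "j < w"
  then have "j < A + B" "w < A + B" using w_eq by auto
  then show "R j \<in> rational_functions_in v"
    unfolding rational_functions_in_def using R_eq P_nonzero P_polys_in by blast
next
  fix y
  assume "y \<in> rat_map_image v w R (Q a (b - 1))"
  then obtain z where z: "z \<in> Q a (b - 1)" and y: "y \<in> cspace w"
    and "\<forall>j<w. rat_has_value v (R j) z (y j)"
    unfolding rat_map_image_def by blast
  then obtain p q where pq: "\<And>j. j < w \<Longrightarrow> R j = Fract (p j) (q j)"
      "\<And>j. j < w \<Longrightarrow> poly_eval (q j) z \<noteq> 0"
      "\<And>j. j < w \<Longrightarrow> y j = poly_eval (p j) z / poly_eval (q j) z"
    unfolding rat_has_value_def by metis
  define x where "x t i = (if i < v then if z i = 0 then complex_of_real t else z i else 0)" for t i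
  define h where "h t = herm a (b - 1) (x t)" for t
  define \<zeta> where "\<zeta> t i = complex_of_real (inverse (sqrt (h t))) * x t i" for t i
  have zv: "z i = 0" if "i \<ge> v" for i
    using z that by (simp add: Q_def cspace_def v_def)
  have x_lim: "((\<lambda>t. x t i) \<longlongrightarrow> z i) (at_right 0)" for i
  proof (cases "i < v \<and> z i = 0")
    case True
    then show ?thesis
      using tendsto_of_real[OF tendsto_ident_at[of "0::real"]] by (simp add: x_def)
  next
    case False
    then consider "i < v" "z i \<noteq> 0" | "v \<le> i" by linarith
    then show ?thesis
      using zv by cases (auto simp: x_def)
  qed
  \<comment> \<open>The limit is the value of the form at \<open>z\<close>, so \<open>h t\<close> is
    positive near 0 and the rescaling factor tends to 1.\<close>
  have h_lim: "(h \<longlongrightarrow> 1) (at_right 0)"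
    using tendsto_herm[of a "b - 1" x z "at_right 0"] x_lim z by (simp add: Q_def h_def[abs_def])
  then have "((\<lambda>t. complex_of_real (inverse (sqrt (h t)))) \<longlongrightarrow> complex_of_real (inverse (sqrt 1))) (at_right 0)"
    by (intro tendsto_intros) auto
  then have \<zeta>_lim: "((\<lambda>t. \<zeta> t i) \<longlongrightarrow> z i) (at_right 0)" for i
    unfolding \<zeta>_def using tendsto_mult[OF _ x_lim[of i]] by force
  define Y where "Y t j = poly_eval (p j) (\<zeta> t) / poly_eval (q j) (\<zeta> t)" for t j
  have Y_lim: "((\<lambda>t. herm A (B - 1) (Y t)) \<longlongrightarrow> herm A (B - 1) y) (at_right 0)"
  proof (rule tendsto_herm)
    fix j
    assume "j < A + (B - 1)"
    then show "((\<lambda>t. Y t j) \<longlongrightarrow> y j) (at_right 0)"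
      unfolding Y_def using pq(2,3)[of j] by (simp add: w_def) (intro tendsto_intros tendsto_poly_eval \<zeta>_lim)
  qed
  have q_ev: "\<forall>\<^sub>F t in at_right 0. \<forall>j\<in>{..<w}. poly_eval (q j) (\<zeta> t) \<noteq> 0"
    by (rule eventually_ball_finite)
      (auto intro!: tendsto_imp_eventually_ne[OF tendsto_poly_eval[OF \<zeta>_lim]] pq(2))
  have h_ev: "\<forall>\<^sub>F t in at_right 0. h t > 0"
    using order_tendstoD(1)[OF h_lim, of 0] by simp
  have t_ev: "\<forall>\<^sub>F t in at_right 0. (0::real) < t"
    by (simp add: eventually_at_right_less)
  have "\<forall>\<^sub>F t in at_right 0. herm A (B - 1) (Y t) = 1"
    using q_ev h_ev t_ev
  proof eventually_elim
    case (elim t)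
    have nz: "\<zeta> t i \<noteq> 0" if "i < v" for i
      using that elim by (simp add: \<zeta>_def x_def)
    have "herm a (b - 1) (\<zeta> t) = 1"
      unfolding \<zeta>_def herm_scale h_def[symmetric] norm_of_real
      using elim by (simp add: power_inverse)
    then have "\<zeta> t \<in> Q a (b - 1)"
      by (simp add: Q_def cspace_def \<zeta>_def x_def v_def)
    then have "herm A (B - 1) (\<lambda>j. image_coord j (\<zeta> t)) = 1"
      using herm_image_coord nz by blast
    \<comment> \<open>At \<open>\<zeta> t\<close> the chosen quotients agree with the monomial ones,
      so the form is eventually 1 along \<open>Y\<close> and hence 1 at the limit
      \<open>y\<close>.\<close>
    moreover have "herm A (B - 1) (Y t) = herm A (B - 1) (\<lambda>j. image_coord j (\<zeta> t))"
    proof (rule herm_cong)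
      fix j
      assume "j < A + (B - 1)"
      then have j: "j < w" "j < A + B" using w_eq by (auto simp: w_def)
      have "poly_eval (p j) (\<zeta> t) / poly_eval (q j) (\<zeta> t) = image_coord j (\<zeta> t)"
      proof (rule image_coord_unique[OF pq(1)[OF j(1)] j(2) pq(2)[OF j(1)]])
        show "poly_eval (q j) (\<zeta> t) \<noteq> 0"
          using elim(1) j(1) by blast
      qed (rule nz)
      then show "cmod (Y t j) = cmod (image_coord j (\<zeta> t))"
        by (simp add: Y_def)
    qed
    ultimately show ?case by simp
  qed
  then have "((\<lambda>t. herm A (B - 1) (Y t)) \<longlongrightarrow> 1) (at_right 0)"
    by (rule tendsto_eventually)
  then have "herm A (B - 1) y = 1"
    using tendsto_unique[OF _ Y_lim] by (simp add: trivial_limit_at_right_real)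
  then show "y \<in> Q A (B - 1)"
    using y by (simp add: Q_def w_def)
qed

text \<open>
  A hyperplane would give a linear relation between the monomials on the torus
  \<open>{z. \<forall>i. \<bar>z i\<bar> = \<bar>\<rho> i\<bar>}\<close> inside the hyperquadric, where distinct monomials of equal degree are
  distinct characters even after the last variable is set to \<open>1\<close>.
\<close>

lemma image_not_in_hyperplane:
  "\<not> (\<exists>H. complex_hyperplane w H \<and> rat_map_image v w R (Q a (b - 1)) \<subseteq> H)"
proof
  assume "\<exists>H. complex_hyperplane w H \<and> rat_map_image v w R (Q a (b - 1)) \<subseteq> H"
  then obtain u V where V: "V \<subseteq> cspace w" "cfun.subspace V" "cfun.dim V + 1 = w"
    and image: "rat_map_image v w R (Q a (b - 1)) \<subseteq> (\<lambda>y. u + y) ` V"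
    unfolding complex_hyperplane_def by blast
  then obtain c :: "nat \<Rightarrow> complex" where c: "\<exists>j<w. c j \<noteq> 0" "\<And>y. y \<in> V \<Longrightarrow> (\<Sum>j<w. c j * y j) = 0"
    using cspace_functional[of V w] by auto
  \<comment> \<open>The functional \<open>c\<close> is constant on the translate
    \<open>u + V\<close>, with value \<open>c0\<close>.\<close>
  define c0 where "c0 = (\<Sum>j<w. c j * u j)"
  have affine: "(\<Sum>j<w. c j * image_coord j z) = c0"
    if z: "z \<in> Q a (b - 1)" "\<And>i. i < v \<Longrightarrow> z i \<noteq> 0" for z
  proof -
    define y where "y j = (if j < w then image_coord j z else 0)" for j
    have "rat_has_value v (R j) z (y j)" if "j < w" for j
    proof -
      have "j < A + B" "w < A + B" using that w_eq by auto
      then show ?thesis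
        unfolding rat_has_value_def y_def image_coord_def
        using R_eq P_polys_in poly_eval_P_nonzero[of w z] z(2) that
        by (intro bexI[of _ "P j"] bexI[of _ "P w"]) auto
    qed
    then have "y \<in> rat_map_image v w R (Q a (b - 1))"
      unfolding rat_map_image_def using z(1) by (auto simp: cspace_def y_def)
    then obtain y' where "y = u + y'" "y' \<in> V" using image by blast
    then have "(\<Sum>j<w. c j * y j) = c0"
      using c(2)[of y'] by (simp add: c0_def distrib_left sum.distrib)
    then show ?thesis by (simp add: y_def)
  qed
  \<comment> \<open>These radii put the torus into \<open>Q a (b - 1)\<close>:
    \<open>a * (b / a) - (b - 1) = 1\<close>.\<close>
  define \<rho> where "\<rho> i = (if i < a then complex_of_real (sqrt (b / a)) else 1)" for i
  define G where "G = {g :: nat \<Rightarrow> complex. (\<forall>i. cmod (g i) = 1) \<and> g v = 1}"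
  \<comment> \<open>Multiplying the affine relation by \<open>P w\<close> makes it linear in the
    monomials; the constant \<open>c0\<close> becomes the coefficient \<open>- c0\<close> at index
    \<open>w\<close>.\<close>
  define k where "k j = (if j < w then c j else - c0) * (r j * mono_eval (\<mu> j) \<rho>)" for j
  have "\<forall>j\<in>{..<A + B}. k j = 0"
  proof (rule characters_independent[where G = G and mul = "\<lambda>g h i. g i * h i" and \<chi> = "\<lambda>j. mono_eval (\<mu> j)"])
    fix g h
    assume "g \<in> G" "h \<in> G"
    then show "(\<lambda>i. g i * h i) \<in> G" by (simp add: G_def norm_mult)
  next
    fix j
    have "(\<lambda>_. 1) \<in> G" "mono_eval (\<mu> j) (\<lambda>_. 1 :: complex) = 1"
      by (simp_all add: G_def mono_eval_def)
    then show "\<exists>g\<in>G. mono_eval (\<mu> j) g \<noteq> 0"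
      by (metis zero_neq_one)
  next
    fix i j
    assume ij: "i \<in> {..<A + B}" "j \<in> {..<A + B}" "i \<noteq> j"
    have keys: "Poly_Mapping.keys (\<mu> i) \<subseteq> {..<Suc v}" "Poly_Mapping.keys (\<mu> j) \<subseteq> {..<Suc v}"
      using keys_mu ij v_eq by auto
    have "\<exists>l<v. Poly_Mapping.lookup (\<mu> i) l \<noteq> Poly_Mapping.lookup (\<mu> j) l"
    proof (rule ccontr)
      assume "\<not> ?thesis"
      then have eq: "Poly_Mapping.lookup (\<mu> i) l = Poly_Mapping.lookup (\<mu> j) l" if "l < v" for l
        using that by blast
      have "mono_degree (\<mu> i) = mono_degree (\<mu> j)"
        using degree_mu ij by simp
      then have "Poly_Mapping.lookup (\<mu> i) v = Poly_Mapping.lookup (\<mu> j) v"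
        using eq keys by (simp add: mono_degree_superset[of "{..<Suc v}"])
      moreover have "Poly_Mapping.lookup (\<mu> i) l = Poly_Mapping.lookup (\<mu> j) l" if "l > v" for l
        using keys that by (metis in_keys_iff lessThan_iff less_Suc_eq_le not_less subsetD)
      ultimately have "\<mu> i = \<mu> j"
        using eq by (intro poly_mapping_eqI) (metis linorder_neqE_nat)
      then show False
        using inj_mu ij by (auto simp: inj_on_def)
    qed
    then obtain l where l: "l < v" "Poly_Mapping.lookup (\<mu> i) l \<noteq> Poly_Mapping.lookup (\<mu> j) l" by blast
    \<comment> \<open>Rotating coordinate \<open>l\<close> by the angle \<open>pi / s\<close> makes
      the ratio of the two characters \<open>cis pi = -1\<close>.\<close>
    define s where "s = real (Poly_Mapping.lookup (\<mu> i) l) - real (Poly_Mapping.lookup (\<mu> j) l)"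
    define g where "g n = (if n = l then cis (pi / s) else 1)" for n
    have g_eval: "mono_eval (\<mu> n) g = cis (pi / s) ^ Poly_Mapping.lookup (\<mu> n) l"
      if "Poly_Mapping.keys (\<mu> n) \<subseteq> {..<Suc v}" for n
    proof -
      have "mono_eval (\<mu> n) g = (\<Prod>i<Suc v. if i = l then cis (pi / s) ^ Poly_Mapping.lookup (\<mu> n) l else 1)"
        unfolding mono_eval_superset[OF finite_lessThan that] g_def by (intro prod.cong) auto
      also have "\<dots> = cis (pi / s) ^ Poly_Mapping.lookup (\<mu> n) l"
        using l by (subst prod.delta) auto
      finally show ?thesis .
    qed
    have "s \<noteq> 0" using l by (simp add: s_def)
    have "real (Poly_Mapping.lookup (\<mu> i) l) = real (Poly_Mapping.lookup (\<mu> j) l) + s"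
      by (simp add: s_def)
    then have "real (Poly_Mapping.lookup (\<mu> i) l) * (pi / s) = real (Poly_Mapping.lookup (\<mu> j) l) * (pi / s) + pi"
      using \<open>s \<noteq> 0\<close> by (simp only: distrib_right) simp
    then have "cis (pi / s) ^ Poly_Mapping.lookup (\<mu> i) l = - (cis (pi / s) ^ Poly_Mapping.lookup (\<mu> j) l)"
      by (simp add: Complex.DeMoivre flip: cis_mult)
    then have "cis (pi / s) ^ Poly_Mapping.lookup (\<mu> i) l \<noteq> cis (pi / s) ^ Poly_Mapping.lookup (\<mu> j) l"
      by simp
    moreover have "g \<in> G"
      using l by (simp add: G_def g_def)
    ultimately show "\<exists>g\<in>G. mono_eval (\<mu> i) g \<noteq> mono_eval (\<mu> j) g"
      using g_eval[of i] g_eval[of j] keys by (intro bexI[of _ g]) auto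
  next
    fix g
    assume "g \<in> G"
    then have g: "\<And>i. cmod (g i) = 1" "g v = 1" by (auto simp: G_def)
    define z where "z i = (if i < v then \<rho> i * g i else 0)" for i
    have \<rho>_nz: "\<rho> i \<noteq> 0" for i
      using a_pos b_pos by (simp add: \<rho>_def)
    then have z_nz: "z i \<noteq> 0" if "i < v" for i
      using that g(1)[of i] by (auto simp: z_def)
    have "herm a (b - 1) z = (\<Sum>j<a. real b / real a) - (\<Sum>j=a..<a + (b - 1). 1)"
      unfolding herm_def
      using b_pos by (intro arg_cong2[of _ _ _ _ "(-)"] sum.cong) (auto simp: z_def v_def \<rho>_def norm_mult g)
    then have "herm a (b - 1) z = 1"
      using a_pos b_pos by (simp add: of_nat_diff)
    then have "z \<in> Q a (b - 1)"
      by (simp add: Q_def cspace_def z_def v_def)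
    then have aff: "(\<Sum>j<w. c j * image_coord j z) = c0"
      using affine z_nz by blast
    have Pw: "poly_eval (P w) z \<noteq> 0"
      using poly_eval_P_nonzero[of w z] z_nz w_eq by simp
    have zg: "(z(v := 1)) i = \<rho> i * g i" if "i < Suc v" for i
      using that g(2) by (auto simp: z_def \<rho>_def v_def less_Suc_eq)
    have Pg: "poly_eval (P j) z = r j * mono_eval (\<mu> j) \<rho> * mono_eval (\<mu> j) g" if "j < A + B" for j
    proof -
      have "mono_eval (\<mu> j) (z(v := 1)) = mono_eval (\<mu> j) (\<lambda>i. \<rho> i * g i)"
        unfolding mono_eval_def
      proof (rule prod.cong[OF refl])
        fix i
        assume "i \<in> Poly_Mapping.keys (\<mu> j)"
        then have "i < Suc v"
          using keys_mu[OF that] v_eq(2) by auto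
        then show "(z(v := 1)) i ^ Poly_Mapping.lookup (\<mu> j) i = (\<rho> i * g i) ^ Poly_Mapping.lookup (\<mu> j) i"
          by (simp only: zg)
      qed
      then show ?thesis
        by (simp add: poly_eval_P poly_eval_F mono_eval_mult)
    qed
    have "(\<Sum>j<w. c j * poly_eval (P j) z) = c0 * poly_eval (P w) z"
      using Pw unfolding aff[symmetric] sum_distrib_right
      by (intro sum.cong) (auto simp: image_coord_def)
    then show "(\<Sum>j\<in>{..<A + B}. k j * mono_eval (\<mu> j) g) = 0"
      unfolding w_eq(2) by (simp add: Pg w_eq k_def mult_ac)
  qed (simp_all add: mono_eval_mult)
  moreover obtain j where j: "j < w" "c j \<noteq> 0" using c(1) by blast
  ultimately have "k j = 0"
    using w_eq(2) by simp
  moreover have "mono_eval (\<mu> j) \<rho> \<noteq> 0"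
    using a_pos b_pos by (intro mono_eval_nonzero) (simp add: \<rho>_def)
  ultimately show False
    using r_pos[of j] j w_eq(2) by (simp add: k_def)
qed

end

text \<open>Positive monomials are enumerated by the indices below \<open>A\<close>, negative ones
  by the next \<open>B\<close>, so that \<open>var_sign A\<close> reproduces the signs of the
  coefficients.\<close>

lemma signature_pair_monomial_map:
  assumes "signature_pair a b A B" "1 \<le> a" "1 \<le> b" "1 \<le> B"
  shows "\<exists>d \<mu> r. monomial_map a b A B d \<mu> r"
proof -
  obtain d c where c: "vanishing_form a b d c" "card {m. c m > 0} = A" "card {m. c m < 0} = B"
    using assms unfolding signature_pair_def by blast
  have fin: "finite {m. c m \<noteq> 0}" using c by (simp add: vanishing_form_def)
  have "finite {m. c m > 0}" by (rule finite_subset[OF _ fin]) auto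
  then obtain f where f: "bij_betw f {..<A} {m. c m > 0}"
    using c(2) by (metis ex_bij_betw_nat_finite atLeast0LessThan)
  have "finite {m. c m < 0}" by (rule finite_subset[OF _ fin]) auto
  then obtain g where g: "bij_betw g {..<B} {m. c m < 0}"
    using c(3) by (metis ex_bij_betw_nat_finite atLeast0LessThan)
  have "bij_betw (\<lambda>j. j - A) {A..<A + B} {..<B}"
    by (rule bij_betw_byWitness[where f' = "\<lambda>j. j + A"]) auto
  then have g': "bij_betw (\<lambda>j. g (j - A)) {A..<A + B} {m. c m < 0}"
    using bij_betw_trans[OF _ g] by (auto simp: o_def)
  define \<mu> where "\<mu> j = (if j < A then f j else g (j - A))" for j
  have "bij_betw \<mu> {..<A} {m. c m > 0}"
    using f by (rule iffD1[OF bij_betw_cong, rotated]) (simp add: \<mu>_def)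
  moreover have "bij_betw \<mu> {A..<A + B} {m. c m < 0}"
    using g' by (rule iffD1[OF bij_betw_cong, rotated]) (simp add: \<mu>_def)
  ultimately have "bij_betw \<mu> ({..<A} \<union> {A..<A + B}) ({m. c m > 0} \<union> {m. c m < 0})"
    by (rule bij_betw_combine) auto
  moreover have "{..<A} \<union> {A..<A + B} = {..<A + B}" "{m. c m > 0} \<union> {m. c m < 0} = {m. c m \<noteq> 0}"
    by auto
  ultimately have bij: "bij_betw \<mu> {..<A + B} {m. c m \<noteq> 0}" by simp
  have pos: "c (\<mu> j) > 0" if "j < A" for j
    using f that by (auto simp: \<mu>_def bij_betw_def)
  have neg: "c (\<mu> j) < 0" if "A \<le> j" "j < A + B" for j
    using bij_betwE[OF g'] that by (auto simp: \<mu>_def)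
  define r where "r j = sqrt \<bar>c (\<mu> j)\<bar>" for j
  have nz: "c (\<mu> j) \<noteq> 0" if "j < A + B" for j
    using bij_betwE[OF bij] that by auto
  have sq: "var_sign A j * (r j)\<^sup>2 = c (\<mu> j)" if "j < A + B" for j
    using pos[of j] neg[of j] that by (auto simp: r_def var_sign_def)
  have "monomial_map a b A B d \<mu> r"
  proof
    fix x :: "nat \<Rightarrow> real"
    assume "(\<Sum>i<a + b. var_sign a i * x i) = 0"
    then have "0 = peval c x"
      using c(1) by (auto simp: vanishing_form_def)
    also have "\<dots> = (\<Sum>j<A + B. c (\<mu> j) * mono_eval (\<mu> j) x)"
      unfolding peval_def by (rule sum.reindex_bij_betw[OF bij, symmetric])
    also have "\<dots> = (\<Sum>j<A + B. var_sign A j * ((r j)\<^sup>2 * mono_eval (\<mu> j) x))"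
      by (intro sum.cong) (auto simp: sq mult.assoc[symmetric])
    finally show "(\<Sum>j<A + B. var_sign A j * ((r j)\<^sup>2 * mono_eval (\<mu> j) x)) = 0" by simp
  qed (use assms nz c(1) bij in \<open>auto simp: vanishing_form_def r_def bij_betw_def\<close>)
  then show ?thesis by blast
qed

theorem theorem9p1:
  fixes a b :: nat
  assumes "b \<ge> 2" and "a \<ge> b"
  shows "\<exists>M :: int. M = (int a)\<^sup>2 + int a * int b - 2 * int a + 1 \<and>
    (\<forall>A B :: nat. A \<ge> 2 \<longrightarrow> B \<ge> 2 \<longrightarrow> int A + int B \<ge> M \<longrightarrow>
       (real B - real b + 1) / real A \<ge> (real b - 1) / real a \<longrightarrow>
       (real A - real b + 1) / real B \<ge> (real b - 1) / real a \<longrightarrow>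
       (\<exists>F. homogeneous_poly_mapping_HQ a b A B F \<and>
            lin_indep_components (A + B) F \<and>
            (let R = dehomogenization (a + b) (A + B) F in
               rational_CR_mapping_Q a (b - 1) A (B - 1) R \<and>
               \<not> (\<exists>H. complex_hyperplane (A + (B - 1)) H \<and>
                      rat_map_image (a + (b - 1)) (A + (B - 1)) R (Q a (b - 1)) \<subseteq> H))))"
proof (intro exI[of _ "(int a)\<^sup>2 + int a * int b - 2 * int a + 1"] conjI allI impI refl)
  fix A B :: nat
  assume AB: "A \<ge> 2" "B \<ge> 2" and M: "int A + int B \<ge> (int a)\<^sup>2 + int a * int b - 2 * int a + 1"
    and cone: "(real B - real b + 1) / real A \<ge> (real b - 1) / real a"
      "(real A - real b + 1) / real B \<ge> (real b - 1) / real a"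
  have sz: "a * (a + b - 2) + 1 \<le> A + B"
  proof -
    have "int (a * (a + b - 2) + 1) = (int a)\<^sup>2 + int a * int b - 2 * int a + 1"
    proof -
      have "int (a + b - 2) = int a + int b - 2"
        using assms by simp
      then have "int (a * (a + b - 2)) = int a * (int a + int b - 2)"
        by (simp only: of_nat_mult)
      then show ?thesis
        by (simp add: power2_eq_square algebra_simps del: of_nat_mult)
    qed
    then show ?thesis using M by linarith
  qed
  \<comment> \<open>Clearing the positive denominators turns each cone condition into an inequality
    of natural numbers.\<close>
  have *: "(b - 1) * X + a * (b - 1) \<le> a * Y"
    if "(real Y - real b + 1) / real X \<ge> (real b - 1) / real a" "X \<ge> 2" for X Y
  proof -
    obtain b' where b': "b = Suc b'"
      using assms by (cases b) auto
    have "real b' * real X \<le> (real Y - real b') * real a"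
      using that assms by (simp add: b' field_simps)
    then have "real (b' * X + a * b') \<le> real (a * Y)"
      by (simp add: algebra_simps)
    then show ?thesis by (simp only: of_nat_le_iff b' diff_Suc_1)
  qed
  have "signature_pair a b A B"
    using signature_pair_exists[OF assms sz *[OF cone(1)] *[OF cone(2)]] AB by simp
  then obtain d \<mu> r where "monomial_map a b A B d \<mu> r"
    using signature_pair_monomial_map[of a b A B] assms AB by auto
  then interpret monomial_map a b A B d \<mu> r .
  show "\<exists>F. homogeneous_poly_mapping_HQ a b A B F \<and>
            lin_indep_components (A + B) F \<and>
            (let R = dehomogenization (a + b) (A + B) F in
               rational_CR_mapping_Q a (b - 1) A (B - 1) R \<and>
               \<not> (\<exists>H. complex_hyperplane (A + (B - 1)) H \<and>
                      rat_map_image (a + (b - 1)) (A + (B - 1)) R (Q a (b - 1)) \<subseteq> H))"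
    using homogeneous_poly_mapping_F lin_indep_F rational_CR_mapping_R image_not_in_hyperplane
    unfolding Let_def v_def w_def by (intro exI[of _ F] conjI)
qed

end
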